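(* Let $G$ be an oriented spatial graph with a diagram $D$, let $p$ be an odd prime, and let $m,k$ be positive integers with $k^m\equiv 1\pmod p$. If $\phi:\pi_1(S^3-G)\to\Gamma(p,m,k)$ is a homomorphism, given by $\phi(a)=\alpha^{\gamma(a)}\beta^{\omega(a)}$ for each generator $a$ of the Wirtinger presentation of $\pi_1(S^3-G)$ obtained from $D$ (with $\gamma(a)\in\mathbb{Z}_p$, $\omega(a)\in\mathbb{Z}_m$), then $\omega$ is a balanced weighting (modulo $m$) of the edges of $G$, and $\gamma$ is a $p$-coloring of $(G,\omega)$ at $k$. Conversely, given a balanced weighting $\omega$ of $G$ and a $p$-coloring $\gamma$ of $(G,\omega)$ at $k$, the assignment $\phi(a)=\alpha^{\gamma(a)}\beta^{\omega(a)}$ on the Wirtinger generators is a well-defined representation (homomorphism) of $\pi_1(S^3-G)$ into $\Gamma(p,m,k)$.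
   Context: An oriented spatial graph $G$ is the image of an embedding in $\mathbb{R}^3\subset S^3$ of a finite abstract directed graph (every component contains at least one vertex). A diagram $D$ is a regular projection to a plane with over/under information; cutting the edges at undercrossings gives the arcs of $D$. Wirtinger presentation of $\pi_1(S^3-G)$ from $D$: generators are the arcs of $D$; at each crossing with overarc $b$ and underarcs $a$ (on the right of $b$) and $c$ (on the left of $b$) there is the relation $bcb^{-1}a^{-1}=1$; at each vertex with incident arc-ends $a_1,\dots,a_n$ in clockwise order (from an arbitrary starting point) with local signs $\varepsilon_i$ ($+1$ if directed into the vertex, $-1$ if directed out) there is the relation $a_1^{\varepsilon_1}\cdots a_n^{\varepsilon_n}=1$. A weighting $\omega$ assigns an integer (or, for a weighting modulo $m$, an element of $\mathbb{Z}_m=\mathbb{Z}/m\mathbb{Z}$) to each edge; the weight of an arc is that of the edge containing it. A function on arcs is regarded as a weighting of the edges if it is constant on the arcs of each edge. The weighting is balanced (modulo $m$) if at each vertex the sum of weights of edges directed in equals (modulo $m$) the sum of weights of edges directed out. A $p$-coloring of $(G,\omega)$ at $k$ (with respect to $D$) is an assignment $\gamma$ of elements of $\mathbb{Z}_p=\mathbb{Z}/p\mathbb{Z}$ to the arcs of $D$ such that, in $\mathbb{Z}_p$: at each crossing with overarc $b$ and underarcs $a$ (on the right of $b$) and $c$ (on the left of $b$), with $b$ of weight $w_1$ and $a,c$ of weight $w_2$, $(1-k^{w_2})\gamma(b)+k^{w_1}\gamma(c)-\gamma(a)=0$; and at each vertex with incident arc-ends $a_1,\dots,a_n$ in clockwise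 order (from an arbitrary starting point) with local signs $\varepsilon_i$ ($+1$ if directed into the vertex, $-1$ if directed out), with $a_i$ of weight $w_i$, $\sum_{i=1}^n\varepsilon_i k^{m_i}\gamma(a_i)=0$, where $m_i=\varepsilon_1w_1+\cdots+\varepsilon_{i-1}w_{i-1}+\min\{\varepsilon_i,0\}w_i$. Since $k^m\equiv1\pmod p$, this depends only on the weights modulo $m$. $\Gamma(p,m,k)=\langle\alpha,\beta\mid \alpha^p=\beta^m=1,\ \beta\alpha\beta^{-1}=\alpha^k\rangle$ is the metacyclic group of order $pm$; each element is uniquely $\alpha^a\beta^b$ with $0\le a\le p-1$, $0\le b\le m-1$. *)

theory Defs
  imports
    "HOL-Analysis.Analysis"
    "HOL-Algebra.Group"
    "HOL-Number_Theory.Number_Theory"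
    "Graph_Theory.Digraph"
begin

section \<open>Groups given by generators and relators\<close>

text \<open>
  A letter \<open>(a, True)\<close> stands for the generator \<open>a\<close>, and \<open>(a, False)\<close> for its inverse.
  The group presented by generators \<open>A\<close> and relators \<open>R\<close> consists of the words over \<open>A\<close>
  modulo the congruence generated by free cancellation and by deletion of relators.
\<close>

type_synonym 'a word = "('a \<times> bool) list"

abbreviation words :: "'a set \<Rightarrow> 'a word set" where
  "words A \<equiv> lists (A \<times> UNIV)"

inductive_set word_cong :: "'a set \<Rightarrow> 'a word set \<Rightarrow> ('a word \<times> 'a word) set"
  for A :: "'a set" and R :: "'a word set" where
  refl: "w \<in> words A \<Longrightarrow> (w, w) \<in> word_cong A R"
| sym: "(v, w) \<in> word_cong A R \<Longrightarrow> (w, v) \<in> word_cong A R"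
| trans: "(u, v) \<in> word_cong A R \<Longrightarrow> (v, w) \<in> word_cong A R \<Longrightarrow> (u, w) \<in> word_cong A R"
| cancel: "u \<in> words A \<Longrightarrow> v \<in> words A \<Longrightarrow> a \<in> A \<Longrightarrow>
    (u @ [(a, s), (a, \<not> s)] @ v, u @ v) \<in> word_cong A R"
| relator: "u \<in> words A \<Longrightarrow> v \<in> words A \<Longrightarrow> r \<in> R \<Longrightarrow> r \<in> words A \<Longrightarrow>
    (u @ r @ v, u @ v) \<in> word_cong A R"

definition presented_group :: "'a set \<Rightarrow> 'a word set \<Rightarrow> 'a word set monoid" where
  "presented_group A R =
    \<lparr>carrier = words A // word_cong A R,
     mult = (\<lambda>X Y. \<Union>x\<in>X. \<Union>y\<in>Y. word_cong A R `` {x @ y}),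
     one = word_cong A R `` {[]}\<rparr>"

definition presented_gen :: "'a set \<Rightarrow> 'a word set \<Rightarrow> 'a \<Rightarrow> 'a word set" where
  "presented_gen A R a = word_cong A R `` {[(a, True)]}"

lemma word_cong_words:
  "(v, w) \<in> word_cong A R \<Longrightarrow> v \<in> words A \<and> w \<in> words A"
  by (induction rule: word_cong.induct) auto

lemma equiv_word_cong: "equiv (words A) (word_cong A R)"
proof (rule equivI)
  show "word_cong A R \<subseteq> words A \<times> words A"
    using word_cong_words by fast
  show "refl_on (words A) (word_cong A R)"
    by (rule refl_onI) (rule word_cong.refl)
  show "sym (word_cong A R)"
    by (rule symI) (rule word_cong.sym)
  show "trans (word_cong A R)"
    by (rule transI) (rule word_cong.trans)
qed

lemma word_cong_append_left:
  assumes "(v, w) \<in> word_cong A R" "x \<in> words A"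
  shows "(x @ v, x @ w) \<in> word_cong A R"
  using assms
proof (induction rule: word_cong.induct)
  case (cancel u v a s)
  then show ?case using word_cong.cancel[of "x @ u" A v a s R] by simp
next
  case (relator u v r)
  then show ?case using word_cong.relator[of "x @ u" A v r R] by simp
next
  case (refl w)
  then show ?case by (intro word_cong.refl) auto
next
  case (sym v w)
  then show ?case by (simp add: word_cong.sym)
next
  case (trans u v w)
  then show ?case by (meson word_cong.trans)
qed

lemma word_cong_append_right:
  assumes "(v, w) \<in> word_cong A R" "x \<in> words A"
  shows "(v @ x, w @ x) \<in> word_cong A R"
  using assms
proof (induction rule: word_cong.induct)
  case (cancel u v a s)
  then show ?case using word_cong.cancel[of u A "v @ x" a s R] by simp
next
  case (relator u v r)
  then show ?case using word_cong.relator[of u A "v @ x" r R] by simp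
next
  case (refl w)
  then show ?case by (intro word_cong.refl) auto
next
  case (sym v w)
  then show ?case by (simp add: word_cong.sym)
next
  case (trans u v w)
  then show ?case by (meson word_cong.trans)
qed

lemma word_cong_append:
  assumes "(v, w) \<in> word_cong A R" "(x, y) \<in> word_cong A R"
  shows "(v @ x, w @ y) \<in> word_cong A R"
proof (rule word_cong.trans)
  show "(v @ x, w @ x) \<in> word_cong A R"
    using assms word_cong_words[OF assms(2)] by (intro word_cong_append_right) simp_all
  show "(w @ x, w @ y) \<in> word_cong A R"
    using assms word_cong_words[OF assms(1)] by (intro word_cong_append_left) simp_all
qed

lemma presented_mult:
  assumes "v \<in> words A" "w \<in> words A"
  shows "word_cong A R `` {v} \<otimes>\<^bsub>presented_group A R\<^esub> word_cong A R `` {w}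
    = word_cong A R `` {v @ w}"
proof -
  have eq: "word_cong A R `` {x @ y} = word_cong A R `` {v @ w}"
    if "x \<in> word_cong A R `` {v}" "y \<in> word_cong A R `` {w}" for x y
  proof -
    have "(v @ w, x @ y) \<in> word_cong A R"
      using that by (simp add: word_cong_append)
    then show ?thesis
      by (rule equiv_class_eq[OF equiv_word_cong, symmetric])
  qed
  have mem: "v \<in> word_cong A R `` {v}" "w \<in> word_cong A R `` {w}"
    unfolding Image_singleton_iff by (rule word_cong.refl, fact)+
  have "(\<Union>y\<in>word_cong A R `` {w}. word_cong A R `` {x @ y}) = word_cong A R `` {v @ w}"
    if "x \<in> word_cong A R `` {v}" for x
    by (rule SUP_eq_const, use mem(2) in blast, rule eq[OF that])
  then have "(\<Union>x\<in>word_cong A R `` {v}. \<Union>y\<in>word_cong A R `` {w}. word_cong A R `` {x @ y})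
      = word_cong A R `` {v @ w}"
    by (intro SUP_eq_const[where I = "word_cong A R `` {v}"]) (use mem(1) in blast)
  then show ?thesis
    unfolding presented_group_def monoid.simps .
qed

lemma words_inverse: "w \<in> words A \<Longrightarrow> rev (map (\<lambda>(a, s). (a, \<not> s)) w) \<in> words A"
  by (auto simp: lists_eq_set)

lemma word_cong_inverse:
  assumes "w \<in> words A"
  shows "(rev (map (\<lambda>(a, s). (a, \<not> s)) w) @ w, []) \<in> word_cong A R"
  using assms
proof (induction w)
  case Nil
  then show ?case by (simp add: word_cong.refl)
next
  case (Cons l w)
  obtain a s where l: "l = (a, s)" by force
  let ?w' = "rev (map (\<lambda>(a, s). (a, \<not> s)) w)"
  have "w \<in> words A" "a \<in> A" using Cons.hyps by (simp_all add: l)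
  moreover from this have "?w' \<in> words A" by (intro words_inverse)
  ultimately have "(?w' @ [(a, \<not> s), (a, \<not> \<not> s)] @ w, ?w' @ w) \<in> word_cong A R"
    by (intro word_cong.cancel)
  then have "(?w' @ [(a, \<not> s), (a, \<not> \<not> s)] @ w, []) \<in> word_cong A R"
    using Cons.IH by (rule word_cong.trans)
  then show ?case by (simp add: l)
qed

lemma carrier_presented_group:
  "X \<in> carrier (presented_group A R) \<longleftrightarrow> (\<exists>v\<in>words A. X = word_cong A R `` {v})"
  by (simp add: presented_group_def quotient_def)

lemma one_presented_group: "\<one>\<^bsub>presented_group A R\<^esub> = word_cong A R `` {[]}"
  by (simp add: presented_group_def)

lemma group_presented_group: "group (presented_group A R)"
proof (rule groupI)
  show "\<one>\<^bsub>presented_group A R\<^esub> \<in> carrier (presented_group A R)"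
    unfolding carrier_presented_group one_presented_group by (rule bexI[OF HOL.refl lists.Nil])
  fix X assume "X \<in> carrier (presented_group A R)"
  then obtain v where v: "v \<in> words A" "X = word_cong A R `` {v}"
    unfolding carrier_presented_group by (elim bexE)
  show "\<one>\<^bsub>presented_group A R\<^esub> \<otimes>\<^bsub>presented_group A R\<^esub> X = X"
    unfolding one_presented_group v(2) presented_mult[OF lists.Nil v(1)] append_Nil by (rule HOL.refl)
  let ?v = "rev (map (\<lambda>(a, s). (a, \<not> s)) v)"
  have v': "?v \<in> words A" using v(1) by (rule words_inverse)
  show "\<exists>Y\<in>carrier (presented_group A R).
      Y \<otimes>\<^bsub>presented_group A R\<^esub> X = \<one>\<^bsub>presented_group A R\<^esub>"
  proof (rule bexI)
    show "word_cong A R `` {?v} \<otimes>\<^bsub>presented_group A R\<^esub> X = \<one>\<^bsub>presented_group A R\<^esub>"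
      unfolding one_presented_group v(2) presented_mult[OF v' v(1)]
      by (rule equiv_class_eq[OF equiv_word_cong word_cong_inverse[OF v(1)]])
    show "word_cong A R `` {?v} \<in> carrier (presented_group A R)"
      unfolding carrier_presented_group using v' by (rule bexI[rotated]) (rule HOL.refl)
  qed
  fix Y assume "Y \<in> carrier (presented_group A R)"
  then obtain w where w: "w \<in> words A" "Y = word_cong A R `` {w}"
    unfolding carrier_presented_group by (elim bexE)
  have vw: "v @ w \<in> words A" using v(1) w(1) by simp
  show "X \<otimes>\<^bsub>presented_group A R\<^esub> Y \<in> carrier (presented_group A R)"
    unfolding v(2) w(2) presented_mult[OF v(1) w(1)] carrier_presented_group
    using vw by (rule bexI[rotated]) (rule HOL.refl)
  fix Z assume "Z \<in> carrier (presented_group A R)"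
  then obtain z where z: "z \<in> words A" "Z = word_cong A R `` {z}"
    unfolding carrier_presented_group by (elim bexE)
  have wz: "w @ z \<in> words A" using w(1) z(1) by simp
  show "X \<otimes>\<^bsub>presented_group A R\<^esub> Y \<otimes>\<^bsub>presented_group A R\<^esub> Z
      = X \<otimes>\<^bsub>presented_group A R\<^esub> (Y \<otimes>\<^bsub>presented_group A R\<^esub> Z)"
    unfolding v(2) w(2) z(2) presented_mult[OF v(1) w(1)] presented_mult[OF w(1) z(1)]
      presented_mult[OF vw z(1)] presented_mult[OF v(1) wz] append_assoc by (rule HOL.refl)
qed


section \<open>The metacyclic group\<close>

datatype metacyclic_gen = Alpha | Beta

definition metacyclic_relators :: "nat \<Rightarrow> nat \<Rightarrow> nat \<Rightarrow> metacyclic_gen word set" where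
  "metacyclic_relators p m k =
    {replicate p (Alpha, True),
     replicate m (Beta, True),
     [(Beta, True), (Alpha, True), (Beta, False)] @ replicate k (Alpha, False)}"

definition metacyclic_group :: "nat \<Rightarrow> nat \<Rightarrow> nat \<Rightarrow> metacyclic_gen word set monoid" where
  "metacyclic_group p m k = presented_group UNIV (metacyclic_relators p m k)"

text \<open>
  Since \<open>\<alpha>\<^sup>p = \<beta>\<^sup>m = 1\<close>, the element below depends only on \<open>a\<close> modulo \<open>p\<close> and \<open>b\<close> modulo \<open>m\<close>.
  Throughout, elements of \<open>\<int>/p\<close> and \<open>\<int>/m\<close> are given by arbitrary integer representatives and
  compared by congruence.
\<close>

definition metacyclic_elem ::
    "nat \<Rightarrow> nat \<Rightarrow> nat \<Rightarrow> int \<Rightarrow> int \<Rightarrow> metacyclic_gen word set" where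
  "metacyclic_elem p m k a b =
    (presented_gen UNIV (metacyclic_relators p m k) Alpha [^]\<^bsub>metacyclic_group p m k\<^esub> a)
    \<otimes>\<^bsub>metacyclic_group p m k\<^esub>
    (presented_gen UNIV (metacyclic_relators p m k) Beta [^]\<^bsub>metacyclic_group p m k\<^esub> b)"


section \<open>The fundamental group of a topological space\<close>

definition loops :: "'a topology \<Rightarrow> 'a \<Rightarrow> (real \<Rightarrow> 'a) set" where
  "loops X x = {f. pathin X f \<and> f 0 = x \<and> f 1 = x}"

definition loop_homotopy :: "'a topology \<Rightarrow> 'a \<Rightarrow> ((real \<Rightarrow> 'a) \<times> (real \<Rightarrow> 'a)) set" where
  "loop_homotopy X x = {(f, g). f \<in> loops X x \<and> g \<in> loops X x \<and>
    homotopic_with (\<lambda>h. h 0 = x \<and> h 1 = x) (top_of_set {0..1}) X f g}"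

text \<open>The operation \<open>+++\<close> on paths is restricted to types of class \<open>topological_space\<close>.\<close>

definition loop_concat :: "(real \<Rightarrow> 'a) \<Rightarrow> (real \<Rightarrow> 'a) \<Rightarrow> real \<Rightarrow> 'a" where
  "loop_concat f g = (\<lambda>t. if t \<le> 1/2 then f (2 * t) else g (2 * t - 1))"

definition fundamental_group :: "'a topology \<Rightarrow> 'a \<Rightarrow> (real \<Rightarrow> 'a) set monoid" where
  "fundamental_group X x =
    \<lparr>carrier = loops X x // loop_homotopy X x,
     mult = (\<lambda>F G. \<Union>f\<in>F. \<Union>g\<in>G. loop_homotopy X x `` {loop_concat f g}),
     one = loop_homotopy X x `` {\<lambda>_. x}\<rparr>"


section \<open>Oriented spatial graphs\<close>

text \<open>
  An abstract finite directed graph (loops and multiple edges allowed) together with a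
  position for each vertex and a parametrization over \<open>[0,1]\<close> of each edge, from its tail to
  its head.
\<close>

record ('v, 'e) spatial_graph =
  abstract_graph :: "('v, 'e) pre_digraph"
  vertex_point :: "'v \<Rightarrow> real^3"
  edge_path :: "'e \<Rightarrow> real \<Rightarrow> real^3"

abbreviation vertices :: "('v, 'e) spatial_graph \<Rightarrow> 'v set" where
  "vertices G \<equiv> verts (abstract_graph G)"

abbreviation edges :: "('v, 'e) spatial_graph \<Rightarrow> 'e set" where
  "edges G \<equiv> arcs (abstract_graph G)"

abbreviation edge_points :: "('v, 'e) spatial_graph \<Rightarrow> ('e \<times> real) set" where
  "edge_points G \<equiv> edges G \<times> {0<..<1}"

definition is_spatial_graph :: "('v, 'e) spatial_graph \<Rightarrow> bool" where
  "is_spatial_graph G \<longleftrightarrow>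
    fin_digraph (abstract_graph G) \<and>
    (\<forall>e\<in>edges G. path (edge_path G e) \<and>
       pathstart (edge_path G e) = vertex_point G (tail (abstract_graph G) e) \<and>
       pathfinish (edge_path G e) = vertex_point G (head (abstract_graph G) e)) \<and>
    inj_on (vertex_point G) (vertices G) \<and>
    inj_on (\<lambda>(e, t). edge_path G e t) (edge_points G) \<and>
    (\<forall>(e, t)\<in>edge_points G. edge_path G e t \<notin> vertex_point G ` vertices G)"

definition graph_image :: "('v, 'e) spatial_graph \<Rightarrow> (real^3) set" where
  "graph_image G =
    vertex_point G ` vertices G \<union> (\<Union>e\<in>edges G. path_image (edge_path G e))"

text \<open>The 3-sphere is the one-point compactification of \<open>\<real>\<^sup>3\<close>.\<close>

definition graph_complement :: "('v, 'e) spatial_graph \<Rightarrow> (real^3) option topology" where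
  "graph_complement G =
    subtopology (Alexandroff_compactification euclidean) (- Some ` graph_image G)"


section \<open>Diagrams\<close>

text \<open>
  The rotation \<open>frame\<close> fixes the plane of projection: after applying it, one projects along
  the third coordinate axis onto the plane of the first two coordinates (identified with the
  complex numbers) and looks at this plane from above, the third coordinate being the height.
  The list \<open>clockwise_ends v\<close> records the arc-ends at \<open>v\<close> in clockwise order from a chosen
  starting point; the arc-end \<open>(e, True)\<close> is the final end of \<open>e\<close> (directed into its head)
  and \<open>(e, False)\<close> the initial end of \<open>e\<close> (directed out of its tail).
\<close>

record ('v, 'e) diagram =
  frame :: "real^3^3"
  clockwise_ends :: "'v \<Rightarrow> ('e \<times> bool) list"

definition shadow :: "('v, 'e) diagram \<Rightarrow> real^3 \<Rightarrow> complex" where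
  "shadow D x = Complex ((frame D *v x) $ 1) ((frame D *v x) $ 2)"

definition height :: "('v, 'e) diagram \<Rightarrow> real^3 \<Rightarrow> real" where
  "height D x = (frame D *v x) $ 3"

abbreviation edge_shadow ::
    "('v, 'e) spatial_graph \<Rightarrow> ('v, 'e) diagram \<Rightarrow> 'e \<Rightarrow> real \<Rightarrow> complex" where
  "edge_shadow G D e t \<equiv> shadow D (edge_path G e t)"

definition edge_tangent ::
    "('v, 'e) spatial_graph \<Rightarrow> ('v, 'e) diagram \<Rightarrow> 'e \<Rightarrow> real \<Rightarrow> complex" where
  "edge_tangent G D e t = vector_derivative (edge_shadow G D e) (at t within {0..1})"

text \<open>A crossing is a pair consisting of its over point and its under point.\<close>

definition crossings ::
    "('v, 'e) spatial_graph \<Rightarrow> ('v, 'e) diagram \<Rightarrow> (('e \<times> real) \<times> ('e \<times> real)) set" where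
  "crossings G D = {((e, s), (f, t)). (e, s) \<in> edge_points G \<and> (f, t) \<in> edge_points G \<and>
    edge_shadow G D e s = edge_shadow G D f t \<and>
    height D (edge_path G e s) > height D (edge_path G f t)}"

text \<open>
  The cross product of the planar vectors \<open>u\<close> and \<open>v\<close>; it is positive iff \<open>v\<close> points to
  the left of \<open>u\<close>.
\<close>

definition planar_cross :: "complex \<Rightarrow> complex \<Rightarrow> real" where
  "planar_cross u v = Im (cnj u * v)"

fun end_direction ::
    "('v, 'e) spatial_graph \<Rightarrow> ('v, 'e) diagram \<Rightarrow> 'e \<times> bool \<Rightarrow> complex" where
  "end_direction G D (e, True) = - edge_tangent G D e 1"
| "end_direction G D (e, False) = edge_tangent G D e 0"

definition clockwise :: "complex list \<Rightarrow> bool" where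
  "clockwise ds \<longleftrightarrow> 0 \<notin> set ds \<and>
    (\<exists>\<theta>. (\<forall>i<length ds. ds ! i = of_real (cmod (ds ! i)) * cis (\<theta> i)) \<and>
         (\<forall>i j. i < j \<and> j < length ds \<longrightarrow> \<theta> j < \<theta> i \<and> \<theta> i < \<theta> j + 2 * pi))"

definition is_diagram :: "('v, 'e) spatial_graph \<Rightarrow> ('v, 'e) diagram \<Rightarrow> bool" where
  "is_diagram G D \<longleftrightarrow>
    rotation_matrix (frame D) \<and>
    \<comment> \<open>vertices are projected to simple points\<close>
    inj_on (\<lambda>v. shadow D (vertex_point G v)) (vertices G) \<and>
    (\<forall>(e, t)\<in>edge_points G. \<forall>v\<in>vertices G.
       edge_shadow G D e t \<noteq> shadow D (vertex_point G v)) \<and>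
    \<comment> \<open>all other multiple points are double points, finite in number and transverse\<close>
    (\<forall>z. card {(e, t) \<in> edge_points G. edge_shadow G D e t = z} \<le> 2 \<and>
         finite {(e, t) \<in> edge_points G. edge_shadow G D e t = z}) \<and>
    finite (crossings G D) \<and>
    (\<forall>((e, s), (f, t))\<in>crossings G D.
       edge_shadow G D e differentiable (at s) \<and>
       edge_shadow G D f differentiable (at t) \<and>
       planar_cross (edge_tangent G D e s) (edge_tangent G D f t) \<noteq> 0) \<and>
    \<comment> \<open>the ends of the edges at a vertex leave it in distinct directions, listed clockwise\<close>
    (\<forall>e\<in>edges G. edge_shadow G D e differentiable (at 0 within {0..1}) \<and>
       edge_shadow G D e differentiable (at 1 within {0..1})) \<and>
    (\<forall>v\<in>vertices G.
       distinct (clockwise_ends D v) \<and>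
       set (clockwise_ends D v) =
         in_arcs (abstract_graph G) v \<times> {True} \<union> out_arcs (abstract_graph G) v \<times> {False} \<and>
       clockwise (map (end_direction G D) (clockwise_ends D v)))"


section \<open>Arcs and the Wirtinger presentation\<close>

text \<open>
  An arc is a pair of an edge and a maximal interval of parameters containing no
  undercrossing. In particular \<open>fst\<close> maps an arc to the edge that contains it.
\<close>

type_synonym 'e diagram_arc = "'e \<times> real set"

definition uncut ::
    "('v, 'e) spatial_graph \<Rightarrow> ('v, 'e) diagram \<Rightarrow> 'e \<Rightarrow> real set" where
  "uncut G D e = {t \<in> {0..1}. (e, t) \<notin> snd ` crossings G D}"

definition diagram_arcs ::
    "('v, 'e) spatial_graph \<Rightarrow> ('v, 'e) diagram \<Rightarrow> 'e diagram_arc set" where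
  "diagram_arcs G D = (SIGMA e:edges G. components (uncut G D e))"

definition arc_at ::
    "('v, 'e) spatial_graph \<Rightarrow> ('v, 'e) diagram \<Rightarrow> 'e \<times> real \<Rightarrow> 'e diagram_arc" where
  "arc_at G D = (\<lambda>(e, t). (e, connected_component_set (uncut G D e) t))"

definition arc_before ::
    "('v, 'e) spatial_graph \<Rightarrow> ('v, 'e) diagram \<Rightarrow> 'e \<times> real \<Rightarrow> 'e diagram_arc" where
  "arc_before G D = (\<lambda>(e, t).
    (e, THE I. I \<in> components (uncut G D e) \<and> (\<forall>\<^sub>F x in at_left t. x \<in> I)))"

definition arc_after ::
    "('v, 'e) spatial_graph \<Rightarrow> ('v, 'e) diagram \<Rightarrow> 'e \<times> real \<Rightarrow> 'e diagram_arc" where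
  "arc_after G D = (\<lambda>(e, t).
    (e, THE I. I \<in> components (uncut G D e) \<and> (\<forall>\<^sub>F x in at_right t. x \<in> I)))"

text \<open>
  If the under strand runs from right to left of the over strand, its part before the
  crossing lies on the right; otherwise on the left.
\<close>

definition under_leftwards ::
    "('v, 'e) spatial_graph \<Rightarrow> ('v, 'e) diagram \<Rightarrow> ('e \<times> real) \<times> ('e \<times> real) \<Rightarrow> bool" where
  "under_leftwards G D = (\<lambda>((e, s), (f, t)).
    planar_cross (edge_tangent G D e s) (edge_tangent G D f t) > 0)"

definition over_arc ::
    "('v, 'e) spatial_graph \<Rightarrow> ('v, 'e) diagram \<Rightarrow> ('e \<times> real) \<times> ('e \<times> real) \<Rightarrow> 'e diagram_arc" where
  "over_arc G D c = arc_at G D (fst c)"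

definition right_arc ::
    "('v, 'e) spatial_graph \<Rightarrow> ('v, 'e) diagram \<Rightarrow> ('e \<times> real) \<times> ('e \<times> real) \<Rightarrow> 'e diagram_arc" where
  "right_arc G D c =
    (if under_leftwards G D c then arc_before G D (snd c) else arc_after G D (snd c))"

definition left_arc ::
    "('v, 'e) spatial_graph \<Rightarrow> ('v, 'e) diagram \<Rightarrow> ('e \<times> real) \<times> ('e \<times> real) \<Rightarrow> 'e diagram_arc" where
  "left_arc G D c =
    (if under_leftwards G D c then arc_after G D (snd c) else arc_before G D (snd c))"

definition end_arc ::
    "('v, 'e) spatial_graph \<Rightarrow> ('v, 'e) diagram \<Rightarrow> 'e \<times> bool \<Rightarrow> 'e diagram_arc" where
  "end_arc G D = (\<lambda>(e, into). arc_at G D (e, if into then 1 else 0))"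

definition end_sign :: "'e \<times> bool \<Rightarrow> int" where
  "end_sign = (\<lambda>(e, into). if into then 1 else - 1)"

definition crossing_relator ::
    "('v, 'e) spatial_graph \<Rightarrow> ('v, 'e) diagram \<Rightarrow> ('e \<times> real) \<times> ('e \<times> real) \<Rightarrow>
     'e diagram_arc word" where
  "crossing_relator G D c =
    [(over_arc G D c, True), (left_arc G D c, True),
     (over_arc G D c, False), (right_arc G D c, False)]"

definition vertex_relator ::
    "('v, 'e) spatial_graph \<Rightarrow> ('v, 'e) diagram \<Rightarrow> 'v \<Rightarrow> 'e diagram_arc word" where
  "vertex_relator G D v =
    map (\<lambda>x. (end_arc G D x, end_sign x = 1)) (clockwise_ends D v)"

definition wirtinger_relators ::
    "('v, 'e) spatial_graph \<Rightarrow> ('v, 'e) diagram \<Rightarrow> 'e diagram_arc word set" where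
  "wirtinger_relators G D =
    crossing_relator G D ` crossings G D \<union> vertex_relator G D ` vertices G"

definition wirtinger_group ::
    "('v, 'e) spatial_graph \<Rightarrow> ('v, 'e) diagram \<Rightarrow> 'e diagram_arc word set monoid" where
  "wirtinger_group G D = presented_group (diagram_arcs G D) (wirtinger_relators G D)"

definition wirtinger_gen ::
    "('v, 'e) spatial_graph \<Rightarrow> ('v, 'e) diagram \<Rightarrow> 'e diagram_arc \<Rightarrow> 'e diagram_arc word set" where
  "wirtinger_gen G D = presented_gen (diagram_arcs G D) (wirtinger_relators G D)"


section \<open>Balanced weightings and colorings\<close>

definition balanced_mod :: "nat \<Rightarrow> ('v, 'e) spatial_graph \<Rightarrow> ('e \<Rightarrow> int) \<Rightarrow> bool" where
  "balanced_mod m G w \<longleftrightarrow> (\<forall>v\<in>vertices G.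
    [(\<Sum>e\<in>in_arcs (abstract_graph G) v. w e) =
     (\<Sum>e\<in>out_arcs (abstract_graph G) v. w e)] (mod int m))"

text \<open>A representative of the power \<open>k\<^sup>i\<close> in \<open>\<int>/p\<close>, for \<open>k\<close> coprime to \<open>p\<close> and any integer \<open>i\<close>.\<close>

definition power_mod :: "nat \<Rightarrow> nat \<Rightarrow> int \<Rightarrow> int" where
  "power_mod p k i =
    (if i \<ge> 0 then int k ^ nat i else modular_inverse (int p) (int k) ^ nat (- i))"

definition vertex_exponent ::
    "('e \<Rightarrow> int) \<Rightarrow> ('e \<times> bool) list \<Rightarrow> nat \<Rightarrow> int" where
  "vertex_exponent w xs i =
    (\<Sum>j<i. end_sign (xs ! j) * w (fst (xs ! j))) + min (end_sign (xs ! i)) 0 * w (fst (xs ! i))"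

definition is_coloring ::
    "nat \<Rightarrow> nat \<Rightarrow> ('v, 'e) spatial_graph \<Rightarrow> ('v, 'e) diagram \<Rightarrow> ('e \<Rightarrow> int) \<Rightarrow>
     ('e diagram_arc \<Rightarrow> int) \<Rightarrow> bool" where
  "is_coloring p k G D w \<gamma> \<longleftrightarrow>
    (\<forall>((e, s), (f, t))\<in>crossings G D.
      [(1 - power_mod p k (w f)) * \<gamma> (over_arc G D ((e, s), (f, t)))
        + power_mod p k (w e) * \<gamma> (left_arc G D ((e, s), (f, t)))
        - \<gamma> (right_arc G D ((e, s), (f, t))) = 0] (mod int p)) \<and>
    (\<forall>v\<in>vertices G. let xs = clockwise_ends D v in
      [(\<Sum>i<length xs. end_sign (xs ! i) * power_mod p k (vertex_exponent w xs i)
          * \<gamma> (end_arc G D (xs ! i))) = 0] (mod int p))"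


section \<open>Homomorphisms given on generators\<close>

text \<open>
  \<open>\<phi>\<close> is a homomorphism from \<open>P\<close> to the metacyclic group taking the element \<open>x a\<close> associated
  with each arc \<open>a\<close> to \<open>\<alpha>\<^sup>\<gamma>\<^sup>(\<^sup>a\<^sup>) \<beta>\<^sup>\<omega>\<^sup>(\<^sup>a\<^sup>)\<close>.
\<close>

definition metacyclic_rep ::
    "nat \<Rightarrow> nat \<Rightarrow> nat \<Rightarrow> 'a set \<Rightarrow> 'g monoid \<Rightarrow> ('a \<Rightarrow> 'g) \<Rightarrow>
     ('a \<Rightarrow> int) \<Rightarrow> ('a \<Rightarrow> int) \<Rightarrow> ('g \<Rightarrow> metacyclic_gen word set) \<Rightarrow> bool" where
  "metacyclic_rep p m k A P x \<gamma> \<omega> \<phi> \<longleftrightarrow>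
    \<phi> \<in> hom P (metacyclic_group p m k) \<and>
    (\<forall>a\<in>A. \<phi> (x a) = metacyclic_elem p m k (\<gamma> a) (\<omega> a))"

end

theory Submission
  imports Defs
begin

text \<open>
  By the universal property of presentations (\<open>presented_group_universal\<close>), a homomorphism from
  the Wirtinger group to the metacyclic group taking each arc \<open>a\<close> to \<open>\<alpha>\<^bsup>\<gamma>(a)\<^esup>\<beta>\<^bsup>\<omega>(a)\<^esup>\<close> exists iff every
  Wirtinger relator takes the value one on these elements. The theorem is thus a computation of
  these values in a normal form.

  The elements \<open>\<alpha>\<^sup>a\<beta>\<^sup>b\<close> multiply by the twisted rule \<open>elem_mult\<close>, in which \<open>k\<^sup>b\<close> acts on the exponent of
  \<open>\<alpha>\<close>, and such an element is trivial only if \<open>p\<close> divides \<open>a\<close> and \<open>m\<close> divides \<open>b\<close> (\<open>elem_eq_one_iff\<close>,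
  by comparison with a concrete semidirect product). Every relation therefore splits into a
  congruence modulo \<open>m\<close> between weights and a congruence modulo \<open>p\<close> between colors. At a crossing
  (\<open>crossing_relator_value_eq_one_iff\<close>) the first says that the two underarcs have the same weight, and
  the second is the coloring condition. At a vertex (\<open>vertex_word_value\<close>) the first is the balance
  condition, and the second is the coloring condition, whose exponents \<open>m\<^sub>i\<close> are the exponents of
  \<open>\<beta>\<close> accumulated while multiplying out the relator.

  What remains is topology of the line: equal weights on the two underarcs of every crossing give
  equal weights on all arcs of an edge (\<open>constant_along_edges\<close>), because the arcs of an edge are
  the pieces of an interval cut at finitely many points. Hence the weights are weights of edges.
  Finally, an isomorphism from the Wirtinger group onto the fundamental group of the complement
  carries representations of one to representations of the other.
\<close>

section \<open>Homomorphisms out of a presented group\<close>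

primrec word_value :: "('g, 'b) monoid_scheme \<Rightarrow> ('a \<Rightarrow> 'g) \<Rightarrow> 'a word \<Rightarrow> 'g" where
  "word_value H f [] = \<one>\<^bsub>H\<^esub>"
| "word_value H f (l # w) =
    (if snd l then f (fst l) else inv\<^bsub>H\<^esub> (f (fst l))) \<otimes>\<^bsub>H\<^esub> word_value H f w"

context group
begin

lemma word_value_closed:
  "f \<in> A \<rightarrow> carrier G \<Longrightarrow> w \<in> words A \<Longrightarrow> word_value G f w \<in> carrier G"
  by (induction w) (auto simp: Pi_iff)

lemma word_value_append:
  assumes "f \<in> A \<rightarrow> carrier G" "v \<in> words A" "w \<in> words A"
  shows "word_value G f (v @ w) = word_value G f v \<otimes> word_value G f w"
  using assms(2)
proof (induction v)
  case Nil
  then show ?case using word_value_closed[OF assms(1,3)] by simp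
next
  case (Cons l v)
  have "f (fst l) \<in> carrier G" using Cons.hyps(1) assms(1) by auto
  then show ?case
    using Cons.IH word_value_closed[OF assms(1) Cons.hyps(2)] word_value_closed[OF assms(1,3)]
    by (simp add: m_assoc)
qed

text \<open>
  Each defining step of the congruence (a free cancellation, or the deletion of a relator)
  removes a factor of value one, so the value of a word depends only on its class.
\<close>
lemma word_value_word_cong:
  assumes f: "f \<in> A \<rightarrow> carrier G"
    and R: "\<And>r. r \<in> R \<Longrightarrow> r \<in> words A \<Longrightarrow> word_value G f r = \<one>"
    and "(v, w) \<in> word_cong A R"
  shows "word_value G f v = word_value G f w"
  using assms(3)
proof (induction rule: word_cong.induct)
  case (cancel u v a s)
  have l: "[(a, s), (a, \<not> s)] \<in> words A" using cancel by simp
  have "f a \<in> carrier G" using f cancel by auto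
  then have "word_value G f [(a, s), (a, \<not> s)] = \<one>" by simp
  then have "word_value G f ([(a, s), (a, \<not> s)] @ v) = word_value G f v"
    using word_value_append[OF f l, of v] word_value_closed[OF f] cancel by simp
  moreover have "[(a, s), (a, \<not> s)] @ v \<in> words A" using cancel by simp
  ultimately show ?case
    using word_value_append[OF f] cancel by metis
next
  case (relator u v r)
  have "word_value G f (r @ v) = word_value G f v"
    using word_value_append[OF f] word_value_closed[OF f] relator R by simp
  moreover have "r @ v \<in> words A" using relator by simp
  ultimately show ?case
    using word_value_append[OF f] relator by metis
qed auto

lemma word_value_replicate:
  assumes "f a \<in> carrier G"
  shows "word_value G f (replicate n (a, s)) = (if s then f a else inv (f a)) [^] n"
proof (induction n)
  case (Suc n)
  let ?x = "if s then f a else inv (f a)"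
  have x: "?x \<in> carrier G" using assms by simp
  have "word_value G f (replicate (Suc n) (a, s)) = ?x \<otimes> ?x [^] n"
    using Suc by simp
  also have "\<dots> = ?x [^] Suc n" using nat_pow_Suc2[OF x] by simp
  finally show ?case .
qed simp

end

lemma word_class_closed:
  "w \<in> words A \<Longrightarrow> word_cong A R `` {w} \<in> carrier (presented_group A R)"
  unfolding carrier_presented_group by blast

lemma presented_gen_closed:
  "a \<in> A \<Longrightarrow> presented_gen A R a \<in> carrier (presented_group A R)"
  unfolding presented_gen_def by (rule word_class_closed) simp

text \<open>
  A homomorphism out of a presented group is determined by the images of the generators. The
  induction on the word needs only that the class of a single inverse letter is the inverse of
  the generator.
\<close>
lemma hom_presented_eq_word_value:
  assumes H: "group H" and \<phi>: "\<phi> \<in> hom (presented_group A R) H" and w: "w \<in> words A"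
  shows "\<phi> (word_cong A R `` {w}) = word_value H (\<lambda>a. \<phi> (presented_gen A R a)) w"
  using w
proof (induction w)
  case Nil
  then show ?case
    using hom_one[OF \<phi> group_presented_group H] by (simp add: one_presented_group)
next
  case (Cons l w)
  interpret P: group "presented_group A R" by (rule group_presented_group)
  interpret h: group_hom "presented_group A R" H \<phi>
    using H \<phi> group_presented_group by (simp add: group_hom_def group_hom_axioms_def)
  obtain a s where l: "l = (a, s)" by force
  have a: "a \<in> A" using Cons.hyps l by simp
  have w: "w \<in> words A" by fact
  have g: "presented_gen A R a \<in> carrier (presented_group A R)"
    using a by (rule presented_gen_closed)
  have wc: "word_cong A R `` {w} \<in> carrier (presented_group A R)"
    using w by (rule word_class_closed)
  have sc: "word_cong A R `` {[(a, s)]} \<in> carrier (presented_group A R)"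
    using a by (intro word_class_closed) simp
  have "word_cong A R `` {[(a, False)]} = inv\<^bsub>presented_group A R\<^esub> presented_gen A R a"
  proof (rule P.inv_equality[symmetric])
    have "([] @ [(a, False), (a, \<not> False)] @ [], [] @ []) \<in> word_cong A R"
      using a by (intro word_cong.cancel) auto
    then have "([(a, False), (a, True)], []) \<in> word_cong A R" by simp
    then show "word_cong A R `` {[(a, False)]} \<otimes>\<^bsub>presented_group A R\<^esub> presented_gen A R a
        = \<one>\<^bsub>presented_group A R\<^esub>"
      using a presented_mult[of "[(a, False)]" A "[(a, True)]" R]
        equiv_class_eq[OF equiv_word_cong]
      by (simp add: presented_gen_def one_presented_group)
    show "word_cong A R `` {[(a, False)]} \<in> carrier (presented_group A R)"
      using a by (intro word_class_closed) simp
  qed (rule g)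
  then have letter: "\<phi> (word_cong A R `` {[(a, s)]})
      = (if s then \<phi> (presented_gen A R a) else inv\<^bsub>H\<^esub> \<phi> (presented_gen A R a))"
    using g by (simp add: presented_gen_def)
  have "word_cong A R `` {l # w}
      = word_cong A R `` {[(a, s)]} \<otimes>\<^bsub>presented_group A R\<^esub> word_cong A R `` {w}"
    using a w presented_mult[of "[(a, s)]" A w R] by (simp add: l)
  then have "\<phi> (word_cong A R `` {l # w})
      = \<phi> (word_cong A R `` {[(a, s)]}) \<otimes>\<^bsub>H\<^esub> \<phi> (word_cong A R `` {w})"
    using h.hom_mult[OF sc wc] by simp
  then show ?case using Cons.IH letter by (simp add: l)
qed

lemma word_value_cong:
  assumes "\<And>a. a \<in> A \<Longrightarrow> f a = g a" "w \<in> words A"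
  shows "word_value H f w = word_value H g w"
  using assms(2) by (induction w) (auto simp: assms(1))

text \<open>
  In one direction a relator represents the identity of the presented group; in the other the
  homomorphism evaluates any word of a class, which is unambiguous because congruent words
  have the same value. The two main uses are the Wirtinger group with values in the metacyclic
  group, and the metacyclic group with values in a concrete model of it.
\<close>
theorem presented_group_universal:
  assumes H: "group H" and f: "f \<in> A \<rightarrow> carrier H"
  shows "(\<exists>\<phi>\<in>hom (presented_group A R) H. \<forall>a\<in>A. \<phi> (presented_gen A R a) = f a) \<longleftrightarrow>
    (\<forall>r\<in>R. r \<in> words A \<longrightarrow> word_value H f r = \<one>\<^bsub>H\<^esub>)"
proof (intro iffI ballI impI)
  fix r assume "\<exists>\<phi>\<in>hom (presented_group A R) H. \<forall>a\<in>A. \<phi> (presented_gen A R a) = f a"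
    and r: "r \<in> R" "r \<in> words A"
  then obtain \<phi> where \<phi>: "\<phi> \<in> hom (presented_group A R) H"
    "\<And>a. a \<in> A \<Longrightarrow> \<phi> (presented_gen A R a) = f a" by blast
  have "([] @ r @ [], [] @ []) \<in> word_cong A R"
    using r by (intro word_cong.relator) auto
  then have "word_cong A R `` {r} = \<one>\<^bsub>presented_group A R\<^esub>"
    using equiv_class_eq[OF equiv_word_cong] by (simp add: one_presented_group)
  then show "word_value H f r = \<one>\<^bsub>H\<^esub>"
    using hom_presented_eq_word_value[OF H \<phi>(1) r(2)] hom_one[OF \<phi>(1) group_presented_group H]
      word_value_cong[of A "\<lambda>a. \<phi> (presented_gen A R a)" f, OF \<phi>(2) r(2)] by metis
next
  assume R: "\<forall>r\<in>R. r \<in> words A \<longrightarrow> word_value H f r = \<one>\<^bsub>H\<^esub>"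
  interpret group H by fact
  define \<phi> where "\<phi> X = word_value H f (SOME w. w \<in> X)" for X
  have \<phi>: "\<phi> (word_cong A R `` {w}) = word_value H f w" if "w \<in> words A" for w
  proof -
    have "(w, SOME v. v \<in> word_cong A R `` {w}) \<in> word_cong A R"
      using someI[of "\<lambda>v. v \<in> word_cong A R `` {w}" w] that by (simp add: word_cong.refl)
    then show ?thesis
      using word_value_word_cong[OF f] R unfolding \<phi>_def by metis
  qed
  show "\<exists>\<phi>\<in>hom (presented_group A R) H. \<forall>a\<in>A. \<phi> (presented_gen A R a) = f a"
  proof (intro bexI[of _ \<phi>] ballI)
    fix a assume "a \<in> A"
    then show "\<phi> (presented_gen A R a) = f a"
      using f \<phi>[of "[(a, True)]"] by (auto simp: presented_gen_def Pi_iff)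
  next
    show "\<phi> \<in> hom (presented_group A R) H"
    proof (rule homI)
      fix X assume "X \<in> carrier (presented_group A R)"
      then obtain v where "v \<in> words A" "X = word_cong A R `` {v}"
        unfolding carrier_presented_group by blast
      then show "\<phi> X \<in> carrier H"
        using \<phi> word_value_closed[OF f] by simp
    next
      fix X Y assume "X \<in> carrier (presented_group A R)" "Y \<in> carrier (presented_group A R)"
      then obtain v w where v: "v \<in> words A" "X = word_cong A R `` {v}"
        and w: "w \<in> words A" "Y = word_cong A R `` {w}"
        unfolding carrier_presented_group by blast
      have "v @ w \<in> words A" using v w by simp
      then show "\<phi> (X \<otimes>\<^bsub>presented_group A R\<^esub> Y) = \<phi> X \<otimes>\<^bsub>H\<^esub> \<phi> Y"
        using v w \<phi> word_value_append[OF f] by (simp add: presented_mult)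
    qed
  qed
qed

text \<open>Universality, applied to the identity homomorphism.\<close>
lemma presented_relator_value:
  assumes "r \<in> R" "r \<in> words A"
  shows "word_value (presented_group A R) (presented_gen A R) r = \<one>\<^bsub>presented_group A R\<^esub>"
proof -
  have "\<exists>\<phi>\<in>hom (presented_group A R) (presented_group A R).
      \<forall>a\<in>A. \<phi> (presented_gen A R a) = presented_gen A R a"
    by (intro bexI[of _ id]) (auto simp: hom_def)
  then show ?thesis
    using presented_group_universal[OF group_presented_group, of "presented_gen A R" A A R R]
      presented_gen_closed assms by fastforce
qed


section \<open>Powers of \<open>k\<close> modulo \<open>p\<close>\<close>

text \<open>
  The congruence makes \<open>k\<close> invertible modulo \<open>p\<close>, so that \<open>k\<^sup>i\<close> is meaningful modulo \<open>p\<close> for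
  every integer \<open>i\<close>, and depends only on \<open>i\<close> modulo \<open>m\<close>.
\<close>
locale metacyclic_parameters =
  fixes p m k :: nat
  assumes p_pos: "p > 0" and m_pos: "m > 0" and k_pow_m: "[k ^ m = 1] (mod p)"
begin

abbreviation P :: "int \<Rightarrow> int" where "P \<equiv> power_mod p k"

lemma coprime_k_p: "coprime (int k) (int p)"
proof -
  have "coprime (k ^ m) p"
    using k_pow_m by (metis cong_imp_coprime cong_sym coprime_1_left)
  then show ?thesis using m_pos by simp
qed

text \<open>
  The representative of \<open>k\<^sup>i\<close> is defined by a case distinction on the sign of \<open>i\<close>. This recurrence
  holds across both cases; additivity in the exponent follows from it by induction, upwards and,
  since \<open>k\<close> may be cancelled modulo \<open>p\<close>, downwards.
\<close>
lemma power_mod_Suc: "[P (i + 1) = int k * P i] (mod int p)"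
proof (cases "i \<ge> 0")
  case True
  then have "nat (i + 1) = Suc (nat i)" by simp
  then show ?thesis using True by (simp add: power_mod_def)
next
  case False
  define j where "j = nat (- i - 1)"
  have i: "i = - int j - 1" using False by (simp add: j_def)
  let ?k' = "modular_inverse (int p) (int k)"
  have kk: "[int k * ?k' = 1] (mod int p)" using coprime_k_p by (rule cong_modular_inverse1)
  have "P (i + 1) = ?k' ^ j"
    by (cases "j = 0") (simp_all add: power_mod_def i)
  moreover have "nat (1 + int j) = Suc j" by simp
  then have "P i = ?k' * ?k' ^ j"
    by (simp add: power_mod_def i)
  ultimately show ?thesis
    using cong_scalar_right[OF kk, of "?k' ^ j"] by (simp add: cong_sym ac_simps)
qed

lemma power_mod_add: "[P (i + j) = P i * P j] (mod int p)"
proof (induction j rule: int_induct[where k = 0])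
  case base
  then show ?case by (simp add: power_mod_def)
next
  case (step1 j)
  have "[P (i + (j + 1)) = int k * P (i + j)] (mod int p)"
    using power_mod_Suc[of "i + j"] by (simp add: add.assoc)
  also have "[int k * P (i + j) = int k * (P i * P j)] (mod int p)"
    using step1 by (intro cong_scalar_left)
  also have "int k * (P i * P j) = P i * (int k * P j)" by simp
  also have "[P i * (int k * P j) = P i * P (j + 1)] (mod int p)"
    by (rule cong_scalar_left[OF cong_sym[OF power_mod_Suc]])
  finally show ?case .
next
  case (step2 j)
  have "[int k * P (i + (j - 1)) = P (i + j)] (mod int p)"
    using power_mod_Suc[of "i + (j - 1)"] by (simp add: algebra_simps cong_sym)
  also have "[P (i + j) = P i * P j] (mod int p)" by (rule step2)
  also have "[P i * P j = P i * (int k * P (j - 1))] (mod int p)"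
    using power_mod_Suc[of "j - 1"] by (intro cong_scalar_left) simp
  finally have "[int k * P (i + (j - 1)) = int k * (P i * P (j - 1))] (mod int p)"
    by (simp add: ac_simps)
  then show ?case using coprime_k_p by (simp add: cong_mult_lcancel)
qed

lemma power_mod_0 [simp]: "P 0 = 1"
  by (simp add: power_mod_def)

lemma power_mod_of_nat: "P (int n) = int k ^ n"
  by (simp add: power_mod_def)

lemma power_mod_mult_m: "[P (int m * q) = 1] (mod int p)"
proof (induction q rule: int_induct[where k = 0])
  have Pm: "[P (int m) = 1] (mod int p)"
    using k_pow_m by (simp add: power_mod_def flip: cong_int_iff)
  {
    case base
    then show ?case by simp
  next
    case (step1 q)
    have "[P (int m * (q + 1)) = P (int m * q) * P (int m)] (mod int p)"
      using power_mod_add[of "int m * q" "int m"] by (simp add: algebra_simps)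
    also have "[P (int m * q) * P (int m) = 1 * 1] (mod int p)"
      using step1 Pm by (intro cong_mult)
    finally show ?case by simp
  next
    case (step2 q)
    have "[P (int m * (q - 1)) = P (int m * (q - 1)) * P (int m)] (mod int p)"
      using cong_scalar_left[OF Pm, of "P (int m * (q - 1))"] by (simp add: cong_sym)
    also have "[P (int m * (q - 1)) * P (int m) = P (int m * q)] (mod int p)"
      using power_mod_add[of "int m * (q - 1)" "int m"] by (simp add: algebra_simps cong_sym)
    also note step2(2)
    finally show ?case .
  }
qed

text \<open>The reason why colorings depend only on the weights modulo \<open>m\<close>.\<close>
lemma power_mod_cong:
  assumes "[i = j] (mod int m)"
  shows "[P i = P j] (mod int p)"
proof -
  obtain q where "j = i + int m * q" using assms by (auto simp: cong_iff_lin)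
  then have "[P j = P i * P (int m * q)] (mod int p)" using power_mod_add by simp
  also have "[P i * P (int m * q) = P i * 1] (mod int p)"
    using power_mod_mult_m by (intro cong_scalar_left)
  finally show ?thesis by (simp add: cong_sym)
qed

section \<open>A normal form in the metacyclic group\<close>

text \<open>
  The semidirect product of \<open>\<int>/p\<close> by \<open>\<int>/m\<close>, where \<open>b\<close> acts as multiplication by \<open>k\<^sup>b\<close>, on least
  nonnegative residues. Mapping \<open>Alpha\<close> to \<open>(1, 0)\<close> and \<open>Beta\<close> to \<open>(0, 1)\<close> takes the
  presented metacyclic group to it and shows that the presentation does not collapse.
\<close>
definition semidirect :: "(int \<times> int) monoid" where
  "semidirect =
    \<lparr>carrier = {0..<int p} \<times> {0..<int m},
     mult = (\<lambda>(a, b) (c, d). ((a + P b * c) mod int p, (b + d) mod int m)),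
     one = (0, 0)\<rparr>"

lemma group_semidirect: "group semidirect"
proof (rule groupI)
  show "\<one>\<^bsub>semidirect\<^esub> \<in> carrier semidirect"
    using p_pos m_pos by (simp add: semidirect_def)
next
  fix x y assume "x \<in> carrier semidirect" "y \<in> carrier semidirect"
  then show "x \<otimes>\<^bsub>semidirect\<^esub> y \<in> carrier semidirect"
    using p_pos m_pos by (auto simp: semidirect_def split: prod.split)
next
  fix x y z :: "int \<times> int"
  obtain a b where x: "x = (a, b)" by force
  obtain c d where y: "y = (c, d)" by force
  obtain e f where z: "z = (e, f)" by force
  have "[(a + P b * c) mod int p + P ((b + d) mod int m) * e
      = (a + P b * c) + (P b * P d) * e] (mod int p)"
  proof (intro cong_add cong_mult cong_refl)
    have "[P ((b + d) mod int m) = P (b + d)] (mod int p)"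
      by (rule power_mod_cong) simp
    then show "[P ((b + d) mod int m) = P b * P d] (mod int p)"
      using power_mod_add cong_trans by blast
  qed simp
  also have "(a + P b * c) + (P b * P d) * e = a + P b * (c + P d * e)"
    by (simp add: algebra_simps)
  also have "[\<dots> = a + P b * ((c + P d * e) mod int p)] (mod int p)"
    by (intro cong_add cong_mult cong_refl) (simp add: cong_def)
  finally show "x \<otimes>\<^bsub>semidirect\<^esub> y \<otimes>\<^bsub>semidirect\<^esub> z
      = x \<otimes>\<^bsub>semidirect\<^esub> (y \<otimes>\<^bsub>semidirect\<^esub> z)"
    by (simp add: semidirect_def x y z cong_def mod_simps ac_simps)
next
  fix x assume x: "x \<in> carrier semidirect"
  then show "\<one>\<^bsub>semidirect\<^esub> \<otimes>\<^bsub>semidirect\<^esub> x = x"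
    by (auto simp: semidirect_def)
  obtain a b where ab: "x = (a, b)" by force
  let ?y = "((- P (- b) * a) mod int p, (- b) mod int m)"
  have "[P ((- b) mod int m) * a = P (- b) * a] (mod int p)"
    by (intro cong_mult power_mod_cong cong_refl) simp
  then have "[(- P (- b) * a) mod int p + P ((- b) mod int m) * a
      = (- P (- b) * a) + P (- b) * a] (mod int p)"
    by (intro cong_add) simp_all
  then have "?y \<otimes>\<^bsub>semidirect\<^esub> x = \<one>\<^bsub>semidirect\<^esub>"
    by (simp add: semidirect_def ab cong_def mod_simps)
  then show "\<exists>y\<in>carrier semidirect. y \<otimes>\<^bsub>semidirect\<^esub> x = \<one>\<^bsub>semidirect\<^esub>"
    using p_pos m_pos by (intro bexI[of _ ?y]) (auto simp: semidirect_def)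
qed

abbreviation \<Gamma> where "\<Gamma> \<equiv> metacyclic_group p m k"
abbreviation \<alpha> where "\<alpha> \<equiv> presented_gen UNIV (metacyclic_relators p m k) Alpha"
abbreviation \<beta> where "\<beta> \<equiv> presented_gen UNIV (metacyclic_relators p m k) Beta"
abbreviation elem where "elem \<equiv> metacyclic_elem p m k"

sublocale \<Gamma>: group \<Gamma>
  unfolding metacyclic_group_def by (rule group_presented_group)

lemma \<alpha>_closed [simp]: "\<alpha> \<in> carrier \<Gamma>" and \<beta>_closed [simp]: "\<beta> \<in> carrier \<Gamma>"
  unfolding metacyclic_group_def by (simp_all add: presented_gen_closed)

lemma elem_alpha_beta: "elem a b = \<alpha> [^]\<^bsub>\<Gamma>\<^esub> a \<otimes>\<^bsub>\<Gamma>\<^esub> \<beta> [^]\<^bsub>\<Gamma>\<^esub> b"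
  by (simp add: metacyclic_elem_def)

lemma elem_closed [simp]: "elem a b \<in> carrier \<Gamma>"
  by (simp add: elem_alpha_beta)

lemma metacyclic_relator_value:
  "r \<in> metacyclic_relators p m k \<Longrightarrow>
    word_value \<Gamma> (presented_gen UNIV (metacyclic_relators p m k)) r = \<one>\<^bsub>\<Gamma>\<^esub>"
  unfolding metacyclic_group_def by (rule presented_relator_value) auto

lemma \<alpha>_pow_p: "\<alpha> [^]\<^bsub>\<Gamma>\<^esub> p = \<one>\<^bsub>\<Gamma>\<^esub>"
proof -
  have "replicate p (Alpha, True) \<in> metacyclic_relators p m k"
    by (simp add: metacyclic_relators_def)
  from metacyclic_relator_value[OF this] show ?thesis
    by (simp add: \<Gamma>.word_value_replicate)
qed

lemma \<beta>_pow_m: "\<beta> [^]\<^bsub>\<Gamma>\<^esub> m = \<one>\<^bsub>\<Gamma>\<^esub>"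
proof -
  have "replicate m (Beta, True) \<in> metacyclic_relators p m k"
    by (simp add: metacyclic_relators_def)
  from metacyclic_relator_value[OF this] show ?thesis
    by (simp add: \<Gamma>.word_value_replicate)
qed

lemma int_pow_cong:
  assumes "x \<in> carrier \<Gamma>" "x [^]\<^bsub>\<Gamma>\<^esub> n = \<one>\<^bsub>\<Gamma>\<^esub>" "[i = j] (mod int n)"
  shows "x [^]\<^bsub>\<Gamma>\<^esub> i = x [^]\<^bsub>\<Gamma>\<^esub> j"
proof -
  obtain q where "j = i + int n * q" using assms(3) by (auto simp: cong_iff_lin)
  then have "x [^]\<^bsub>\<Gamma>\<^esub> j = x [^]\<^bsub>\<Gamma>\<^esub> i \<otimes>\<^bsub>\<Gamma>\<^esub> (x [^]\<^bsub>\<Gamma>\<^esub> int n) [^]\<^bsub>\<Gamma>\<^esub> q"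
    using assms(1) by (simp add: \<Gamma>.int_pow_mult \<Gamma>.int_pow_pow)
  then show ?thesis using assms by (simp add: int_pow_int)
qed

lemma elem_cong:
  "[a = a'] (mod int p) \<Longrightarrow> [b = b'] (mod int m) \<Longrightarrow> elem a b = elem a' b'"
  using int_pow_cong[OF \<alpha>_closed \<alpha>_pow_p] int_pow_cong[OF \<beta>_closed \<beta>_pow_m]
  by (simp add: elem_alpha_beta)

lemma \<beta>_\<alpha>: "\<beta> \<otimes>\<^bsub>\<Gamma>\<^esub> \<alpha> \<otimes>\<^bsub>\<Gamma>\<^esub> inv\<^bsub>\<Gamma>\<^esub> \<beta> = \<alpha> [^]\<^bsub>\<Gamma>\<^esub> k"
proof -
  let ?g = "presented_gen UNIV (metacyclic_relators p m k)"
  have "word_value \<Gamma> ?g ([(Beta, True), (Alpha, True), (Beta, False)] @ replicate k (Alpha, False))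
      = \<one>\<^bsub>\<Gamma>\<^esub>"
    by (rule metacyclic_relator_value) (simp add: metacyclic_relators_def)
  then have "(\<beta> \<otimes>\<^bsub>\<Gamma>\<^esub> \<alpha> \<otimes>\<^bsub>\<Gamma>\<^esub> inv\<^bsub>\<Gamma>\<^esub> \<beta>) \<otimes>\<^bsub>\<Gamma>\<^esub> inv\<^bsub>\<Gamma>\<^esub> (\<alpha> [^]\<^bsub>\<Gamma>\<^esub> k) = \<one>\<^bsub>\<Gamma>\<^esub>"
    by (simp add: \<Gamma>.word_value_replicate \<Gamma>.m_assoc \<Gamma>.nat_pow_inv)
  then show ?thesis
    by (metis \<Gamma>.inv_equality \<Gamma>.inv_inv \<Gamma>.inv_closed \<Gamma>.m_closed \<Gamma>.nat_pow_closed \<alpha>_closed \<beta>_closed)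
qed

text \<open>
  Conjugation by \<open>\<beta>\<close> is an endomorphism, so the relation for \<open>\<beta>\<alpha>\<beta>\<inverse>\<close> extends to all powers of \<open>\<alpha>\<close>.
\<close>
lemma \<beta>_\<alpha>_pow: "\<beta> \<otimes>\<^bsub>\<Gamma>\<^esub> \<alpha> [^]\<^bsub>\<Gamma>\<^esub> (c :: int) = \<alpha> [^]\<^bsub>\<Gamma>\<^esub> (int k * c) \<otimes>\<^bsub>\<Gamma>\<^esub> \<beta>"
proof -
  let ?h = "\<lambda>x. \<beta> \<otimes>\<^bsub>\<Gamma>\<^esub> x \<otimes>\<^bsub>\<Gamma>\<^esub> inv\<^bsub>\<Gamma>\<^esub> \<beta>"
  have "?h \<in> hom \<Gamma> \<Gamma>"
  proof (rule homI)
    fix x y assume xy: "x \<in> carrier \<Gamma>" "y \<in> carrier \<Gamma>"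
    have "inv\<^bsub>\<Gamma>\<^esub> \<beta> \<otimes>\<^bsub>\<Gamma>\<^esub> (\<beta> \<otimes>\<^bsub>\<Gamma>\<^esub> z) = z" if "z \<in> carrier \<Gamma>" for z
      using that by (simp flip: \<Gamma>.m_assoc)
    then show "?h (x \<otimes>\<^bsub>\<Gamma>\<^esub> y) = ?h x \<otimes>\<^bsub>\<Gamma>\<^esub> ?h y"
      using xy by (simp add: \<Gamma>.m_assoc)
  qed simp
  then interpret h: group_hom \<Gamma> \<Gamma> ?h
    by (simp add: group_hom_def group_hom_axioms_def \<Gamma>.group_axioms)
  have "?h (\<alpha> [^]\<^bsub>\<Gamma>\<^esub> c) = (\<alpha> [^]\<^bsub>\<Gamma>\<^esub> k) [^]\<^bsub>\<Gamma>\<^esub> c"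
    using h.hom_int_pow[OF \<alpha>_closed, of c] \<beta>_\<alpha> by simp
  also have "\<dots> = \<alpha> [^]\<^bsub>\<Gamma>\<^esub> (int k * c)"
    using \<Gamma>.int_pow_pow[OF \<alpha>_closed, of "int k" c] by (simp add: int_pow_int)
  finally show ?thesis
    by (metis \<Gamma>.inv_solve_right' \<Gamma>.int_pow_closed \<Gamma>.m_closed \<alpha>_closed \<beta>_closed)
qed

text \<open>
  Because \<open>\<beta>\<close> has finite order, negative powers of \<open>\<beta>\<close> reduce to nonnegative ones, for which
  the rule is iterated.
\<close>
lemma \<beta>_pow_\<alpha>_pow:
  "\<beta> [^]\<^bsub>\<Gamma>\<^esub> (b :: int) \<otimes>\<^bsub>\<Gamma>\<^esub> \<alpha> [^]\<^bsub>\<Gamma>\<^esub> (c :: int) = \<alpha> [^]\<^bsub>\<Gamma>\<^esub> (P b * c) \<otimes>\<^bsub>\<Gamma>\<^esub> \<beta> [^]\<^bsub>\<Gamma>\<^esub> b"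
proof -
  have nat: "\<beta> [^]\<^bsub>\<Gamma>\<^esub> n \<otimes>\<^bsub>\<Gamma>\<^esub> \<alpha> [^]\<^bsub>\<Gamma>\<^esub> c = \<alpha> [^]\<^bsub>\<Gamma>\<^esub> (int k ^ n * c) \<otimes>\<^bsub>\<Gamma>\<^esub> \<beta> [^]\<^bsub>\<Gamma>\<^esub> n" for n :: nat
  proof (induction n arbitrary: c)
    case (Suc n)
    have "\<beta> [^]\<^bsub>\<Gamma>\<^esub> Suc n \<otimes>\<^bsub>\<Gamma>\<^esub> \<alpha> [^]\<^bsub>\<Gamma>\<^esub> c = \<beta> [^]\<^bsub>\<Gamma>\<^esub> n \<otimes>\<^bsub>\<Gamma>\<^esub> \<alpha> [^]\<^bsub>\<Gamma>\<^esub> (int k * c) \<otimes>\<^bsub>\<Gamma>\<^esub> \<beta>"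
      by (simp add: \<Gamma>.m_assoc \<beta>_\<alpha>_pow)
    also have "\<dots> = \<alpha> [^]\<^bsub>\<Gamma>\<^esub> (int k ^ Suc n * c) \<otimes>\<^bsub>\<Gamma>\<^esub> \<beta> [^]\<^bsub>\<Gamma>\<^esub> Suc n"
      by (simp add: Suc \<Gamma>.m_assoc ac_simps)
    finally show ?case .
  qed simp
  define n where "n = nat (b mod int m)"
  have n: "int n = b mod int m" using m_pos by (simp add: n_def)
  have b: "\<beta> [^]\<^bsub>\<Gamma>\<^esub> b = \<beta> [^]\<^bsub>\<Gamma>\<^esub> n"
    using int_pow_cong[OF \<beta>_closed \<beta>_pow_m, of b "int n"]
    unfolding n int_pow_int[symmetric] by simp
  have "[b = int n] (mod int m)" unfolding n by simp
  then have "[P b = int k ^ n] (mod int p)"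
    using power_mod_cong unfolding power_mod_of_nat[symmetric] by blast
  then have "\<alpha> [^]\<^bsub>\<Gamma>\<^esub> (P b * c) = \<alpha> [^]\<^bsub>\<Gamma>\<^esub> (int k ^ n * c)"
    by (intro int_pow_cong[OF \<alpha>_closed \<alpha>_pow_p] cong_scalar_right)
  then show ?thesis using nat b by simp
qed

text \<open>
  The source of the powers of \<open>k\<close> in the coloring conditions: moving a power of \<open>\<alpha>\<close> to the left
  past \<open>\<beta>\<^sup>b\<close> multiplies its exponent by \<open>k\<^sup>b\<close>.
\<close>
lemma elem_mult: "elem a b \<otimes>\<^bsub>\<Gamma>\<^esub> elem c d = elem (a + P b * c) (b + d)"
proof -
  have "elem a b \<otimes>\<^bsub>\<Gamma>\<^esub> elem c d
      = \<alpha> [^]\<^bsub>\<Gamma>\<^esub> a \<otimes>\<^bsub>\<Gamma>\<^esub> (\<beta> [^]\<^bsub>\<Gamma>\<^esub> b \<otimes>\<^bsub>\<Gamma>\<^esub> \<alpha> [^]\<^bsub>\<Gamma>\<^esub> c) \<otimes>\<^bsub>\<Gamma>\<^esub> \<beta> [^]\<^bsub>\<Gamma>\<^esub> d"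
    by (simp add: elem_alpha_beta \<Gamma>.m_assoc)
  then show ?thesis
    by (simp add: elem_alpha_beta \<beta>_pow_\<alpha>_pow \<Gamma>.m_assoc \<Gamma>.int_pow_mult)
qed

lemma elem_0_0: "elem 0 0 = \<one>\<^bsub>\<Gamma>\<^esub>"
  by (simp add: elem_alpha_beta)

lemma elem_inv: "inv\<^bsub>\<Gamma>\<^esub> elem a b = elem (- P (- b) * a) (- b)"
  by (rule \<Gamma>.inv_equality) (simp_all add: elem_mult elem_0_0)

text \<open>
  Uniqueness of the normal form, which turns one relation in the group into two congruences.
  The direction from left to right is read off in \<open>semidirect\<close>.
\<close>
lemma elem_eq_one_iff: "elem a b = \<one>\<^bsub>\<Gamma>\<^esub> \<longleftrightarrow> [a = 0] (mod int p) \<and> [b = 0] (mod int m)"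
proof
  assume "[a = 0] (mod int p) \<and> [b = 0] (mod int m)"
  then show "elem a b = \<one>\<^bsub>\<Gamma>\<^esub>" using elem_cong[of a 0 b 0] elem_0_0 by simp
next
  interpret S: group semidirect by (rule group_semidirect)
  define f where "f = (\<lambda>g. case g of Alpha \<Rightarrow> (1 mod int p, 0) | Beta \<Rightarrow> (0, 1 mod int m))"
  have f: "f g \<in> carrier semidirect" for g
    using p_pos m_pos by (simp add: f_def semidirect_def split: metacyclic_gen.split)
  have fA: "f Alpha [^]\<^bsub>semidirect\<^esub> n = (int n mod int p, 0)" for n :: nat
    by (induction n) (simp_all add: f_def semidirect_def mod_simps ac_simps)
  have fB: "f Beta [^]\<^bsub>semidirect\<^esub> n = (0, int n mod int m)" for n :: nat
    by (induction n) (simp_all add: f_def semidirect_def mod_simps ac_simps)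
  have one: "\<one>\<^bsub>semidirect\<^esub> = (0, 0)" by (simp add: semidirect_def)
  have "\<forall>r\<in>metacyclic_relators p m k. r \<in> words UNIV \<longrightarrow>
      word_value semidirect f r = \<one>\<^bsub>semidirect\<^esub>"
  proof (intro ballI impI)
    fix r assume "r \<in> metacyclic_relators p m k"
    then consider "r = replicate p (Alpha, True)" | "r = replicate m (Beta, True)"
      | "r = [(Beta, True), (Alpha, True), (Beta, False)] @ replicate k (Alpha, False)"
      by (auto simp: metacyclic_relators_def)
    then show "word_value semidirect f r = \<one>\<^bsub>semidirect\<^esub>"
    proof cases
      case 1
      then show ?thesis by (simp add: S.word_value_replicate f fA one)
    next
      case 2
      then show ?thesis by (simp add: S.word_value_replicate f fB one)
    next
      case 3
      have "[P (1 mod int m) * (1 mod int p) = P 1 * 1] (mod int p)"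
        by (intro cong_mult power_mod_cong) simp_all
      then have "f Beta \<otimes>\<^bsub>semidirect\<^esub> f Alpha
          = (f Alpha [^]\<^bsub>semidirect\<^esub> k) \<otimes>\<^bsub>semidirect\<^esub> f Beta"
        unfolding fA by (simp add: f_def semidirect_def cong_def power_mod_def mod_simps)
      then have "f Beta \<otimes>\<^bsub>semidirect\<^esub> f Alpha \<otimes>\<^bsub>semidirect\<^esub> inv\<^bsub>semidirect\<^esub> f Beta
          = f Alpha [^]\<^bsub>semidirect\<^esub> k"
        using f by (simp add: S.m_assoc)
      then have "f Beta \<otimes>\<^bsub>semidirect\<^esub> f Alpha \<otimes>\<^bsub>semidirect\<^esub> inv\<^bsub>semidirect\<^esub> f Beta
          \<otimes>\<^bsub>semidirect\<^esub> inv\<^bsub>semidirect\<^esub> (f Alpha [^]\<^bsub>semidirect\<^esub> k) = \<one>\<^bsub>semidirect\<^esub>"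
        using f by simp
      then show ?thesis
        using f by (simp add: 3 S.word_value_replicate S.nat_pow_inv S.m_assoc)
    qed
  qed
  then obtain \<phi> where \<phi>: "\<phi> \<in> hom \<Gamma> semidirect" "\<phi> \<alpha> = f Alpha" "\<phi> \<beta> = f Beta"
    using presented_group_universal[OF group_semidirect, of f UNIV "metacyclic_relators p m k"] f
    unfolding metacyclic_group_def by auto
  interpret \<phi>: group_hom \<Gamma> semidirect \<phi>
    using \<phi>(1) by (simp add: group_hom_def group_hom_axioms_def \<Gamma>.group_axioms S.group_axioms)
  assume e: "elem a b = \<one>\<^bsub>\<Gamma>\<^esub>"
  \<comment> \<open>Passing to nonnegative exponents makes the powers computable by \<open>fA\<close> and \<open>fB\<close>.\<close>
  define a' b' where "a' = nat (a mod int p)" and "b' = nat (b mod int m)"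
  have ab: "int a' = a mod int p" "int b' = b mod int m"
    using p_pos m_pos by (simp_all add: a'_def b'_def)
  have "elem (int a') (int b') = \<one>\<^bsub>\<Gamma>\<^esub>"
    using e elem_cong[of "int a'" a "int b'" b] by (simp add: ab)
  then have "\<phi> (\<alpha> [^]\<^bsub>\<Gamma>\<^esub> a' \<otimes>\<^bsub>\<Gamma>\<^esub> \<beta> [^]\<^bsub>\<Gamma>\<^esub> b') = \<one>\<^bsub>semidirect\<^esub>"
    by (simp add: elem_alpha_beta int_pow_int)
  then have "f Alpha [^]\<^bsub>semidirect\<^esub> a' \<otimes>\<^bsub>semidirect\<^esub> f Beta [^]\<^bsub>semidirect\<^esub> b' = \<one>\<^bsub>semidirect\<^esub>"
    by (simp add: \<phi>.hom_nat_pow \<phi>(2,3))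
  then show "[a = 0] (mod int p) \<and> [b = 0] (mod int m)"
    unfolding fA fB by (simp add: semidirect_def ab cong_def)
qed

end


section \<open>The pieces of an interval cut at finitely many points\<close>

text \<open>
  The connected set \<open>V\<close> lies in one component; any other component is disjoint from it, whereas two
  sets that both hold eventually along a proper filter must meet.
\<close>
lemma component_beside_unique:
  assumes F: "F \<noteq> bot" and "V \<subseteq> U" "connected V" "V \<noteq> {}" "\<forall>\<^sub>F x in F. x \<in> V"
  shows "\<exists>!I. I \<in> components U \<and> (\<forall>\<^sub>F x in F. x \<in> I)"
proof (rule ex_ex1I)
  obtain v where v: "v \<in> V" using assms by blast
  let ?I = "connected_component_set U v"
  have "V \<subseteq> ?I" using assms v by (intro connected_component_maximal) auto
  then have "\<forall>\<^sub>F x in F. x \<in> ?I" using assms(5) by (auto elim: eventually_mono)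
  moreover have "?I \<in> components U" using v assms by (intro componentsI) auto
  ultimately show "\<exists>I. I \<in> components U \<and> (\<forall>\<^sub>F x in F. x \<in> I)" by blast
next
  fix I J
  assume IJ: "I \<in> components U \<and> (\<forall>\<^sub>F x in F. x \<in> I)" "J \<in> components U \<and> (\<forall>\<^sub>F x in F. x \<in> J)"
  then have "\<forall>\<^sub>F x in F. x \<in> I \<inter> J" by (auto intro: eventually_conj)
  then have "I \<inter> J \<noteq> {}" using F by (metis empty_iff eventually_False eventually_mono)
  then show "I = J" using IJ components_eq by blast
qed

lemma cut_interval_gap:
  fixes K :: "real set"
  assumes "finite K"
  obtains d where "d > 0" "{0..1} \<inter> {t - d<..<t} \<subseteq> {0..1} - K" "{0..1} \<inter> {t<..<t + d} \<subseteq> {0..1} - K"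
proof -
  obtain d where d: "d > 0" "\<And>x. x \<in> K \<Longrightarrow> x \<noteq> t \<Longrightarrow> d \<le> dist t x"
    using finite_set_avoid[OF assms, of t] by blast
  show thesis
  proof (rule that[OF d(1)])
    show "{0..1} \<inter> {t - d<..<t} \<subseteq> {0..1} - K"
      using d(2) by (force simp: dist_real_def)
    show "{0..1} \<inter> {t<..<t + d} \<subseteq> {0..1} - K"
      using d(2) by (force simp: dist_real_def)
  qed
qed

lemma cut_interval_beside:
  fixes K :: "real set" and t :: real
  assumes K: "finite K" and t: "0 < t" "t < 1"
  shows "\<exists>!I. I \<in> components ({0..1} - K) \<and> (\<forall>\<^sub>F x in at_left t. x \<in> I)"
    and "\<exists>!I. I \<in> components ({0..1} - K) \<and> (\<forall>\<^sub>F x in at_right t. x \<in> I)"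
proof -
  obtain d where d: "d > 0"
    "{0..1} \<inter> {t - d<..<t} \<subseteq> {0..1} - K" "{0..1} \<inter> {t<..<t + d} \<subseteq> {0..1} - K"
    using cut_interval_gap[OF K] by blast
  let ?L = "{max 0 (t - d)<..<t}" and ?R = "{t<..<min 1 (t + d)}"
  show "\<exists>!I. I \<in> components ({0..1} - K) \<and> (\<forall>\<^sub>F x in at_left t. x \<in> I)"
  proof (rule component_beside_unique[of _ ?L])
    show "?L \<subseteq> {0..1} - K" using d(2) t by (intro order.trans[OF _ d(2)]) auto
    show "?L \<noteq> {}" using t d(1) by simp
    show "\<forall>\<^sub>F x in at_left t. x \<in> ?L" using t d(1) by (intro eventually_at_leftI[of "max 0 (t - d)"]) auto
  qed auto
  show "\<exists>!I. I \<in> components ({0..1} - K) \<and> (\<forall>\<^sub>F x in at_right t. x \<in> I)"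
  proof (rule component_beside_unique[of _ ?R])
    show "?R \<subseteq> {0..1} - K" using t by (intro order.trans[OF _ d(3)]) auto
    show "?R \<noteq> {}" using t d(1) by simp
    show "\<forall>\<^sub>F x in at_right t. x \<in> ?R" using t d(1) by (intro eventually_at_rightI[of _ "min 1 (t + d)"]) auto
  qed auto
qed

text \<open>
  A quantity attached to the pieces of the cut interval that agrees on the two sides of every
  cut is the same on all pieces: extended to the cut points by its value just before them, it
  becomes a locally constant function on the connected interval \<open>[0,1]\<close>.
\<close>
lemma cut_interval_constant:
  fixes K :: "real set" and F :: "real set \<Rightarrow> 'a"
  assumes K: "finite K" "K \<subseteq> {0<..<1}"
    and F: "\<And>t I J. t \<in> K \<Longrightarrow> I \<in> components ({0..1} - K) \<Longrightarrow> J \<in> components ({0..1} - K) \<Longrightarrow>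
      \<forall>\<^sub>F x in at_left t. x \<in> I \<Longrightarrow> \<forall>\<^sub>F x in at_right t. x \<in> J \<Longrightarrow> F I = F J"
    and I: "I \<in> components ({0..1} - K)" "J \<in> components ({0..1} - K)"
  shows "F I = F J"
proof -
  let ?U = "{0..1} - K"
  define before where "before t = (THE I. I \<in> components ?U \<and> (\<forall>\<^sub>F x in at_left t. x \<in> I))" for t
  define h where "h t = F (if t \<in> ?U then connected_component_set ?U t else before t)" for t
  have h_comp: "h t = F I" if "I \<in> components ?U" "t \<in> I" for t I
  proof -
    have "t \<in> ?U" using in_components_subset that by blast
    moreover have "I = connected_component_set ?U t"
      using that by (metis componentsE connected_component_eq)
    ultimately show ?thesis by (simp add: h_def)
  qed
  have "h constant_on {0..1}"
  proof (rule locally_constant_imp_constant)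
    fix a :: real assume a: "a \<in> {0..1}"
    obtain d where d: "d > 0"
      "{0..1} \<inter> {a - d<..<a} \<subseteq> ?U" "{0..1} \<inter> {a<..<a + d} \<subseteq> ?U"
      using cut_interval_gap[OF K(1)] by blast
    let ?T = "{0..1} \<inter> {a - d<..<a + d}"
    have "\<forall>x\<in>?T. h x = h a"
    proof (cases "a \<in> K")
      \<comment> \<open>Away from the cuts a whole neighbourhood of \<open>a\<close> lies in the piece that contains \<open>a\<close>.\<close>
      case False
      have T: "?T \<subseteq> ?U"
      proof
        fix x assume "x \<in> ?T"
        then consider "x \<in> {0..1} \<inter> {a - d<..<a}" | "x = a" | "x \<in> {0..1} \<inter> {a<..<a + d}"
          by (cases x a rule: linorder_cases) auto
        then show "x \<in> ?U" using d(2,3) a False by cases blast+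
      qed
      have "connected ?T" by (intro convex_connected convex_Int) simp_all
      then have sub: "?T \<subseteq> connected_component_set ?U a"
        using T a d(1) by (intro connected_component_maximal) auto
      have "connected_component_set ?U a \<in> components ?U"
        using a False by (intro componentsI) auto
      note const = h_comp[OF this]
      have "a \<in> ?T" using a d(1) by simp
      then have "h a = F (connected_component_set ?U a)"
        using sub by (intro const) blast
      then show ?thesis
        using sub by (intro ballI) (metis const subsetD)
    next
      case True
      then have a01: "0 < a" "a < 1" using K by auto
      \<comment> \<open>At a cut the neighbourhood consists of \<open>a\<close> and of parts of the two adjacent pieces \<open>B\<close> and \<open>A\<close>,
        on which \<open>F\<close> agrees by assumption.\<close>
      let ?L = "{0..1} \<inter> {a - d<..<a}" and ?R = "{0..1} \<inter> {a<..<a + d}"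
      obtain B where B: "B \<in> components ?U" "\<forall>\<^sub>F x in at_left a. x \<in> B" "before a = B"
        using cut_interval_beside(1)[OF K(1) a01] theI'[OF cut_interval_beside(1)[OF K(1) a01]]
        unfolding before_def by blast
      obtain A where A: "A \<in> components ?U" "\<forall>\<^sub>F x in at_right a. x \<in> A"
        using cut_interval_beside(2)[OF K(1) a01] by blast
      have ha: "h a = F B" using True B(3) by (simp add: h_def)
      have L: "?L \<subseteq> B"
      proof -
        have "\<forall>\<^sub>F x in at_left a. x \<in> ?L"
          using a01 d(1) by (intro eventually_at_leftI[of "max 0 (a - d)"]) auto
        then have "\<forall>\<^sub>F x in at_left a. x \<in> ?L \<and> x \<in> B"
          using B(2) by (rule eventually_conj)
        then have "B \<inter> ?L \<noteq> {}"
          using eventually_happens'[OF trivial_limit_at_left_real] by blast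
        moreover have "connected ?L" by (intro convex_connected convex_Int) simp_all
        ultimately show ?thesis using components_maximal[OF B(1) _ d(2)] by blast
      qed
      have R: "?R \<subseteq> A"
      proof -
        have "\<forall>\<^sub>F x in at_right a. x \<in> ?R"
          using a01 d(1) by (intro eventually_at_rightI[of _ "min 1 (a + d)"]) auto
        then have "\<forall>\<^sub>F x in at_right a. x \<in> ?R \<and> x \<in> A"
          using A(2) by (rule eventually_conj)
        then have "A \<inter> ?R \<noteq> {}"
          using eventually_happens'[OF trivial_limit_at_right_real] by blast
        moreover have "connected ?R" by (intro convex_connected convex_Int) simp_all
        ultimately show ?thesis using components_maximal[OF A(1) _ d(3)] by blast
      qed
      have FAB: "F B = F A" using F[OF True B(1) A(1) B(2) A(2)] .
      show ?thesis
      proof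
        fix x assume "x \<in> ?T"
        then consider "x \<in> ?L" | "x = a" | "x \<in> ?R" by (cases x a rule: linorder_cases) auto
        then show "h x = h a"
          using L R h_comp[OF B(1)] h_comp[OF A(1)] FAB ha by cases auto
      qed
    qed
    moreover have "a \<in> ?T" using a d(1) by simp
    moreover have "openin (top_of_set {0..1}) ?T" by (intro openin_open_Int) simp
    ultimately show "\<exists>T. openin (top_of_set {0..1}) T \<and> a \<in> T \<and> (\<forall>x\<in>T. h x = h a)"
      by blast
  qed simp
  then obtain c where c: "\<And>t. t \<in> {0..1} \<Longrightarrow> h t = c" by (auto simp: constant_on_def)
  have "F I = c" if I: "I \<in> components ?U" for I
  proof -
    obtain t where t: "t \<in> I" using in_components_nonempty[OF I] by blast
    then have "t \<in> {0..1}" using in_components_subset[OF I] by blast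
    then show ?thesis using c h_comp[OF I t] by simp
  qed
  then show ?thesis using I by simp
qed

section \<open>Arcs of a diagram\<close>

lemma undercrossing_parameters:
  assumes "is_diagram G D"
  shows "finite {t. (e, t) \<in> snd ` crossings G D}"
    and "{t. (e, t) \<in> snd ` crossings G D} \<subseteq> {0<..<1}"
    and "uncut G D e = {0..1} - {t. (e, t) \<in> snd ` crossings G D}"
proof -
  have "finite (snd ` snd ` crossings G D)" using assms by (simp add: is_diagram_def)
  then show "finite {t. (e, t) \<in> snd ` crossings G D}"
    by (rule rev_finite_subset) force
qed (auto simp: crossings_def uncut_def)

text \<open>
  The arcs before and after an undercrossing are given by definite descriptions, which are
  justified here by the finiteness of the set of undercrossings.
\<close>
lemma arcs_beside_undercrossing:
  assumes "is_diagram G D" "(x, (f, t)) \<in> crossings G D"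
  obtains I J where "arc_before G D (f, t) = (f, I)" "arc_after G D (f, t) = (f, J)"
    "I \<in> components (uncut G D f)" "J \<in> components (uncut G D f)"
    "\<And>I'. I' \<in> components (uncut G D f) \<Longrightarrow> \<forall>\<^sub>F x in at_left t. x \<in> I' \<Longrightarrow> I' = I"
    "\<And>J'. J' \<in> components (uncut G D f) \<Longrightarrow> \<forall>\<^sub>F x in at_right t. x \<in> J' \<Longrightarrow> J' = J"
proof -
  note K = undercrossing_parameters[OF assms(1), of f]
  have t: "0 < t" "t < 1" using assms(2) by (auto simp: crossings_def)
  note L = cut_interval_beside(1)[OF K(1) t, folded K(3)]
  note R = cut_interval_beside(2)[OF K(1) t, folded K(3)]
  show thesis
    by (rule that[of "THE I. I \<in> components (uncut G D f) \<and> (\<forall>\<^sub>F x in at_left t. x \<in> I)"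
          "THE I. I \<in> components (uncut G D f) \<and> (\<forall>\<^sub>F x in at_right t. x \<in> I)"])
      (use theI'[OF L] theI'[OF R] L R in \<open>auto simp: arc_before_def arc_after_def\<close>)
qed

lemma arc_at_in_diagram_arcs:
  "e \<in> edges G \<Longrightarrow> t \<in> uncut G D e \<Longrightarrow> arc_at G D (e, t) \<in> diagram_arcs G D"
  by (auto simp: arc_at_def diagram_arcs_def intro: componentsI)

lemma fst_arc_at [simp]: "fst (arc_at G D x) = fst x"
  by (simp add: arc_at_def split: prod.split)

lemma fst_over_arc [simp]: "fst (over_arc G D ((e, s), (f, t))) = e"
  by (simp add: over_arc_def)

lemma fst_left_arc [simp]: "fst (left_arc G D ((e, s), (f, t))) = f"
  by (simp add: left_arc_def arc_before_def arc_after_def)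

lemma fst_right_arc [simp]: "fst (right_arc G D ((e, s), (f, t))) = f"
  by (simp add: right_arc_def arc_before_def arc_after_def)

lemma fst_end_arc [simp]: "fst (end_arc G D x) = fst x"
  by (simp add: end_arc_def split: prod.split)

text \<open>
  An over point lies inside an arc: if it were also an under point of another strand, then three
  points at different heights would have the same shadow, but a diagram has only double points.
\<close>
lemma over_point_uncut:
  assumes D: "is_diagram G D" and c: "((e, s), (f, t)) \<in> crossings G D"
  shows "s \<in> uncut G D e"
proof (rule ccontr)
  assume "s \<notin> uncut G D e"
  moreover have "s \<in> {0..1}" using c by (auto simp: crossings_def)
  ultimately obtain g r where c': "((g, r), (e, s)) \<in> crossings G D"
    by (auto simp: uncut_def)
  let ?S = "{(e', t') \<in> edge_points G. edge_shadow G D e' t' = edge_shadow G D e s}"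
  have sub: "{(g, r), (e, s), (f, t)} \<subseteq> ?S" using c c' by (auto simp: crossings_def)
  have "card {(g, r), (e, s), (f, t)} = 3"
    using c c' by (auto simp: crossings_def card_insert_if)
  moreover have "finite ?S \<and> card ?S \<le> 2" using D unfolding is_diagram_def by blast
  ultimately show False using card_mono[of ?S, OF _ sub] by linarith
qed

lemma over_arc_in_diagram_arcs:
  "is_diagram G D \<Longrightarrow> c \<in> crossings G D \<Longrightarrow> over_arc G D c \<in> diagram_arcs G D"
  using over_point_uncut
  by (cases c) (fastforce simp: over_arc_def crossings_def intro: arc_at_in_diagram_arcs)

lemma under_arcs_in_diagram_arcs:
  assumes "is_diagram G D" "c \<in> crossings G D"
  shows "left_arc G D c \<in> diagram_arcs G D" "right_arc G D c \<in> diagram_arcs G D"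
proof -
  obtain x f t where c: "c = (x, (f, t))" by (metis prod.exhaust)
  have f: "f \<in> edges G" using assms(2) by (auto simp: c crossings_def)
  obtain I J where "arc_before G D (f, t) = (f, I)" "arc_after G D (f, t) = (f, J)"
    "I \<in> components (uncut G D f)" "J \<in> components (uncut G D f)"
    using arcs_beside_undercrossing[OF assms[unfolded c]] by metis
  then show "left_arc G D c \<in> diagram_arcs G D" "right_arc G D c \<in> diagram_arcs G D"
    using f by (auto simp: c left_arc_def right_arc_def diagram_arcs_def)
qed

lemma clockwise_ends_set:
  assumes "is_diagram G D" "v \<in> vertices G"
  shows "distinct (clockwise_ends D v)"
    and "set (clockwise_ends D v) =
      in_arcs (abstract_graph G) v \<times> {True} \<union> out_arcs (abstract_graph G) v \<times> {False}"
  using assms by (auto simp: is_diagram_def)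

lemma end_arc_in_diagram_arcs:
  assumes "is_diagram G D" "v \<in> vertices G" "x \<in> set (clockwise_ends D v)"
  shows "end_arc G D x \<in> diagram_arcs G D"
proof -
  obtain e i where x: "x = (e, i)" by force
  have "e \<in> edges G" using assms clockwise_ends_set(2)[OF assms(1,2)] by (auto simp: x)
  moreover have "(if i then 1 else 0) \<in> uncut G D e"
    by (auto simp: uncut_def crossings_def)
  ultimately show ?thesis by (simp add: end_arc_def x arc_at_in_diagram_arcs)
qed

text \<open>
  A presentation only imposes relators that are words over its generators, so this is what makes
  every Wirtinger relator effective.
\<close>
lemma wirtinger_relators_words:
  assumes "is_diagram G D"
  shows "wirtinger_relators G D \<subseteq> words (diagram_arcs G D)"
proof
  fix r assume "r \<in> wirtinger_relators G D"
  then consider c where "c \<in> crossings G D" "r = crossing_relator G D c"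
    | v where "v \<in> vertices G" "r = vertex_relator G D v"
    by (auto simp: wirtinger_relators_def)
  then show "r \<in> words (diagram_arcs G D)"
  proof cases
    case 1
    then show ?thesis
      using over_arc_in_diagram_arcs[OF assms 1(1)] under_arcs_in_diagram_arcs[OF assms 1(1)]
      by (simp add: crossing_relator_def)
  next
    case 2
    then show ?thesis
      using end_arc_in_diagram_arcs[OF assms] by (auto simp: vertex_relator_def)
  qed
qed

text \<open>
  Consecutive arcs of an edge are the left and right arcs of a crossing, so a quantity preserved
  by all crossings is a quantity attached to the edges.
\<close>
lemma constant_along_edges:
  assumes D: "is_diagram G D"
    and F: "\<And>c. c \<in> crossings G D \<Longrightarrow> F (left_arc G D c) = F (right_arc G D c)"
    and a: "a \<in> diagram_arcs G D"
  shows "F a = F (arc_at G D (fst a, 0))"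
proof -
  obtain e I where aI: "a = (e, I)" by force
  have I: "I \<in> components (uncut G D e)" using a by (simp add: aI diagram_arcs_def)
  have "0 \<in> uncut G D e" by (auto simp: uncut_def crossings_def)
  then have J: "connected_component_set (uncut G D e) 0 \<in> components (uncut G D e)"
    by (rule componentsI)
  note K = undercrossing_parameters[OF D, of e]
  have "F (e, I) = F (e, connected_component_set (uncut G D e) 0)"
  proof (rule cut_interval_constant[OF K(1,2), where F = "\<lambda>I. F (e, I)", folded K(3), OF _ I J])
    fix t A B
    assume t: "t \<in> {t. (e, t) \<in> snd ` crossings G D}"
      and AB: "A \<in> components (uncut G D e)" "B \<in> components (uncut G D e)"
        "\<forall>\<^sub>F x in at_left t. x \<in> A" "\<forall>\<^sub>F x in at_right t. x \<in> B"
    then obtain y where c: "(y, (e, t)) \<in> crossings G D" by auto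
    have "arc_before G D (e, t) = (e, A)" "arc_after G D (e, t) = (e, B)"
      using arcs_beside_undercrossing[OF D c] AB by metis+
    then show "F (e, A) = F (e, B)"
      using F[OF c] by (auto simp: left_arc_def right_arc_def split: if_splits)
  qed
  then show ?thesis by (simp add: aI arc_at_def)
qed


section \<open>Wirtinger relations in the metacyclic group\<close>

text \<open>
  A loop at \<open>v\<close> contributes two different arc-ends and appears in both sums.
\<close>
lemma signed_sum_clockwise_ends:
  assumes "is_diagram G D" "v \<in> vertices G"
  shows "(\<Sum>x\<leftarrow>clockwise_ends D v. end_sign x * w (fst x)) =
    (\<Sum>e\<in>in_arcs (abstract_graph G) v. w e) - (\<Sum>e\<in>out_arcs (abstract_graph G) v. w e)"
proof -
  let ?I = "in_arcs (abstract_graph G) v" and ?O = "out_arcs (abstract_graph G) v"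
  let ?f = "\<lambda>x. end_sign x * w (fst x)"
  have ends: "set (clockwise_ends D v) = (\<lambda>e. (e, True)) ` ?I \<union> (\<lambda>e. (e, False)) ` ?O"
    using clockwise_ends_set(2)[OF assms] by auto
  then have fin: "finite ((\<lambda>e. (e, True)) ` ?I)" "finite ((\<lambda>e. (e, False)) ` ?O)"
    by (metis finite_Un finite_set)+
  have "(\<Sum>x\<leftarrow>clockwise_ends D v. ?f x) = sum ?f (set (clockwise_ends D v))"
    using clockwise_ends_set(1)[OF assms] by (rule sum_list_distinct_conv_sum_set)
  also have "\<dots> = sum ?f ((\<lambda>e. (e, True)) ` ?I) + sum ?f ((\<lambda>e. (e, False)) ` ?O)"
    unfolding ends using fin by (intro sum.union_disjoint) auto
  also have "\<dots> = (\<Sum>e\<in>?I. w e) - (\<Sum>e\<in>?O. w e)"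
    by (simp add: sum.reindex inj_on_def end_sign_def sum_negf)
  finally show ?thesis .
qed

context metacyclic_parameters
begin

text \<open>
  In the normal form of \<open>bcb\<inverse>a\<inverse>\<close> the exponent of \<open>\<beta>\<close> is the difference of the weights of \<open>c\<close> and
  \<open>a\<close>. Once these weights agree, the powers of \<open>k\<close> in the exponent of \<open>\<alpha>\<close> reduce to those of the
  coloring condition.
\<close>
lemma crossing_relator_value_eq_one_iff:
  "word_value \<Gamma> (\<lambda>a. elem (\<gamma> a) (\<omega> a)) (crossing_relator G D c) = \<one>\<^bsub>\<Gamma>\<^esub> \<longleftrightarrow>
    [\<omega> (left_arc G D c) = \<omega> (right_arc G D c)] (mod int m) \<and>
    [(1 - P (\<omega> (left_arc G D c))) * \<gamma> (over_arc G D c)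
      + P (\<omega> (over_arc G D c)) * \<gamma> (left_arc G D c) - \<gamma> (right_arc G D c) = 0] (mod int p)"
proof -
  define b l r where "b = over_arc G D c" and "l = left_arc G D c" and "r = right_arc G D c"
  let ?s = "\<gamma> b + P (\<omega> b) * (\<gamma> l + P (\<omega> l) * (- P (- \<omega> b) * \<gamma> b + P (- \<omega> b) * (- P (- \<omega> r) * \<gamma> r)))"
  let ?t = "(1 - P (\<omega> l)) * \<gamma> b + P (\<omega> b) * \<gamma> l - \<gamma> r"
  have word: "word_value \<Gamma> (\<lambda>a. elem (\<gamma> a) (\<omega> a)) (crossing_relator G D c) = elem ?s (\<omega> l - \<omega> r)"
    by (simp add: crossing_relator_def elem_mult elem_inv flip: b_def l_def r_def)
  have "[?s = ?t] (mod int p)" if lr: "[\<omega> l = \<omega> r] (mod int m)"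
  proof -
    have b: "[P (\<omega> b) * P (- \<omega> b) = 1] (mod int p)"
      using power_mod_add[of "\<omega> b" "- \<omega> b"] by (simp add: cong_sym)
    have r: "[P (\<omega> l) * P (- \<omega> r) = 1] (mod int p)"
      using power_mod_add[of "\<omega> l" "- \<omega> r"] power_mod_cong[of "\<omega> l - \<omega> r" 0] lr
      by (metis add_uminus_conv_diff cong_diff_iff_cong_0 cong_sym cong_trans power_mod_0)
    have "?s = \<gamma> b + P (\<omega> b) * \<gamma> l - P (\<omega> l) * \<gamma> b * (P (\<omega> b) * P (- \<omega> b))
        - (P (\<omega> b) * P (- \<omega> b)) * (P (\<omega> l) * P (- \<omega> r)) * \<gamma> r"
      by (simp add: algebra_simps)
    also have "[\<dots> = \<gamma> b + P (\<omega> b) * \<gamma> l - P (\<omega> l) * \<gamma> b * 1 - 1 * 1 * \<gamma> r] (mod int p)"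
      using b r by (intro cong_diff cong_mult cong_refl)
    also have "\<gamma> b + P (\<omega> b) * \<gamma> l - P (\<omega> l) * \<gamma> b * 1 - 1 * 1 * \<gamma> r = ?t"
      by (simp add: algebra_simps)
    finally show ?thesis .
  qed
  then have "[?s = 0] (mod int p) \<longleftrightarrow> [?t = 0] (mod int p)" if "[\<omega> l = \<omega> r] (mod int m)"
    using that cong_trans cong_sym by blast
  then show ?thesis
    unfolding word elem_eq_one_iff cong_diff_iff_cong_0 b_def[symmetric] l_def[symmetric] r_def[symmetric]
    by blast
qed

text \<open>
  The new exponent of \<open>k\<close> already includes the weight of the inverted factor. This is the origin of
  the summand \<open>min {\<epsilon>\<^sub>i, 0} w\<^sub>i\<close> in the exponent \<open>m\<^sub>i\<close> of the vertex condition.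
\<close>
lemma elem_mult_inv: "elem a b \<otimes>\<^bsub>\<Gamma>\<^esub> inv\<^bsub>\<Gamma>\<^esub> elem c d = elem (a - P (b - d) * c) (b - d)"
proof -
  have "[P (b - d) * c = P b * P (- d) * c] (mod int p)"
    using power_mod_add[of b "- d"] by (intro cong_scalar_right) simp
  then have "[a - P b * P (- d) * c = a - P (b - d) * c] (mod int p)"
    by (rule cong_diff[OF cong_refl cong_sym])
  then have "elem (a + P b * (- P (- d) * c)) (b + - d) = elem (a - P (b - d) * c) (b - d)"
    by (intro elem_cong) (simp_all add: mult.assoc)
  then show ?thesis by (simp only: elem_inv elem_mult)
qed

text \<open>
  Multiplying from left to right, the exponent of \<open>\<beta>\<close> accumulated so far is the partial signed sum
  of weights, and it twists the exponent of \<open>\<alpha>\<close> of the next factor. The induction therefore extends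
  the list at its end.
\<close>
lemma vertex_word_value:
  "word_value \<Gamma> (\<lambda>a. elem (\<gamma> a) (w (fst a))) (map (\<lambda>x. (end_arc G D x, end_sign x = 1)) xs) =
    elem (\<Sum>i<length xs. end_sign (xs ! i) * P (vertex_exponent w xs i) * \<gamma> (end_arc G D (xs ! i)))
      (\<Sum>x\<leftarrow>xs. end_sign x * w (fst x))"
proof (induction xs rule: rev_induct)
  case Nil
  then show ?case by (simp add: elem_0_0)
next
  case (snoc x xs)
  let ?f = "\<lambda>a. elem (\<gamma> a) (w (fst a))"
  let ?W = "\<Sum>x\<leftarrow>xs. end_sign x * w (fst x)"
  let ?S = "\<lambda>xs. \<Sum>i<length xs. end_sign (xs ! i) * P (vertex_exponent w xs i) * \<gamma> (end_arc G D (xs ! i))"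
  have prefix: "vertex_exponent w (xs @ [x]) i = vertex_exponent w xs i" if "i < length xs" for i
    using that by (simp add: vertex_exponent_def nth_append)
  have W: "?W = (\<Sum>j<length xs. end_sign (xs ! j) * w (fst (xs ! j)))"
    by (simp add: sum_list_sum_nth atLeast0LessThan)
  then have last: "vertex_exponent w (xs @ [x]) (length xs) = ?W + min (end_sign x) 0 * w (fst x)"
    by (simp add: vertex_exponent_def nth_append)
  have S: "?S (xs @ [x]) = ?S xs
      + end_sign x * P (?W + min (end_sign x) 0 * w (fst x)) * \<gamma> (end_arc G D x)"
    by (simp add: nth_append prefix last)
  have "word_value \<Gamma> ?f (map (\<lambda>x. (end_arc G D x, end_sign x = 1)) (xs @ [x]))
      = elem (?S xs) ?W \<otimes>\<^bsub>\<Gamma>\<^esub> word_value \<Gamma> ?f [(end_arc G D x, end_sign x = 1)]"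
    using \<Gamma>.word_value_append[of ?f UNIV "map (\<lambda>x. (end_arc G D x, end_sign x = 1)) xs"
        "[(end_arc G D x, end_sign x = 1)]"] snoc by simp
  also have "\<dots> = elem (?S (xs @ [x])) (?W + end_sign x * w (fst x))"
  proof (cases "snd x")
    case True
    then have x: "end_sign x = 1" by (cases x) (simp add: end_sign_def)
    show ?thesis unfolding S by (simp add: x elem_mult)
  next
    case False
    then have x: "end_sign x = - 1" by (cases x) (simp add: end_sign_def)
    show ?thesis unfolding S by (simp add: x elem_mult_inv)
  qed
  finally show ?case by simp
qed

lemma wirtinger_relators_hold_iff_coloring:
  assumes "is_diagram G D"
  shows "(\<forall>r\<in>wirtinger_relators G D. word_value \<Gamma> (\<lambda>a. elem (\<gamma> a) (w (fst a))) r = \<one>\<^bsub>\<Gamma>\<^esub>) \<longleftrightarrow>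
    balanced_mod m G w \<and> is_coloring p k G D w \<gamma>"
proof -
  let ?value = "word_value \<Gamma> (\<lambda>a. elem (\<gamma> a) (w (fst a)))"
  have crossing: "?value (crossing_relator G D ((e, s), (f, t))) = \<one>\<^bsub>\<Gamma>\<^esub> \<longleftrightarrow>
      [(1 - P (w f)) * \<gamma> (over_arc G D ((e, s), (f, t))) + P (w e) * \<gamma> (left_arc G D ((e, s), (f, t)))
        - \<gamma> (right_arc G D ((e, s), (f, t))) = 0] (mod int p)" for e s f t
    by (simp add: crossing_relator_value_eq_one_iff)
  have vertex: "?value (vertex_relator G D v) = \<one>\<^bsub>\<Gamma>\<^esub> \<longleftrightarrow>
      [(\<Sum>i<length (clockwise_ends D v). end_sign (clockwise_ends D v ! i)
          * P (vertex_exponent w (clockwise_ends D v) i)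
          * \<gamma> (end_arc G D (clockwise_ends D v ! i))) = 0] (mod int p) \<and>
      [(\<Sum>e\<in>in_arcs (abstract_graph G) v. w e) = (\<Sum>e\<in>out_arcs (abstract_graph G) v. w e)] (mod int m)"
    if "v \<in> vertices G" for v
    unfolding vertex_relator_def vertex_word_value elem_eq_one_iff
      signed_sum_clockwise_ends[OF assms that] cong_diff_iff_cong_0 ..
  have "(\<forall>r\<in>wirtinger_relators G D. ?value r = \<one>\<^bsub>\<Gamma>\<^esub>) \<longleftrightarrow>
      (\<forall>((e, s), (f, t))\<in>crossings G D. ?value (crossing_relator G D ((e, s), (f, t))) = \<one>\<^bsub>\<Gamma>\<^esub>) \<and>
      (\<forall>v\<in>vertices G. ?value (vertex_relator G D v) = \<one>\<^bsub>\<Gamma>\<^esub>)"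
    by (auto simp: wirtinger_relators_def)
  then show ?thesis
    unfolding crossing balanced_mod_def is_coloring_def Let_def using vertex by auto
qed

lemma wirtinger_rep_iff_relators_hold:
  assumes "is_diagram G D"
  shows "(\<exists>\<phi>. metacyclic_rep p m k (diagram_arcs G D) (wirtinger_group G D) (wirtinger_gen G D) \<gamma> \<omega> \<phi>) \<longleftrightarrow>
    (\<forall>r\<in>wirtinger_relators G D. word_value \<Gamma> (\<lambda>a. elem (\<gamma> a) (\<omega> a)) r = \<one>\<^bsub>\<Gamma>\<^esub>)"
proof -
  have "(\<lambda>a. elem (\<gamma> a) (\<omega> a)) \<in> diagram_arcs G D \<rightarrow> carrier \<Gamma>" by simp
  note universal = presented_group_universal[OF \<Gamma>.group_axioms this, of "wirtinger_relators G D"]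
  have words: "(\<forall>r\<in>wirtinger_relators G D. r \<in> words (diagram_arcs G D) \<longrightarrow> Q r) \<longleftrightarrow>
      (\<forall>r\<in>wirtinger_relators G D. Q r)" for Q
    using wirtinger_relators_words[OF assms] by blast
  show ?thesis
    using universal unfolding words
    by (simp only: metacyclic_rep_def wirtinger_group_def wirtinger_gen_def Bex_def)
qed

text \<open>
  The crossing relators alone force the exponents of \<open>\<beta>\<close> to agree along each edge; the value at the
  initial arc of an edge serves as its weight.
\<close>
theorem wirtinger_rep_iff_coloring:
  assumes D: "is_diagram G D"
  shows "(\<exists>\<phi>. metacyclic_rep p m k (diagram_arcs G D) (wirtinger_group G D) (wirtinger_gen G D) \<gamma> \<omega> \<phi>) \<longleftrightarrow>
    (\<exists>w. (\<forall>a\<in>diagram_arcs G D. [\<omega> a = w (fst a)] (mod int m)) \<and>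
      balanced_mod m G w \<and> is_coloring p k G D w \<gamma>)"
proof -
  let ?value = "\<lambda>\<omega>. word_value \<Gamma> (\<lambda>a. elem (\<gamma> a) (\<omega> a))"
  have edge_weights: "(\<forall>r\<in>wirtinger_relators G D. ?value \<omega> r = \<one>\<^bsub>\<Gamma>\<^esub>) \<longleftrightarrow>
      balanced_mod m G w \<and> is_coloring p k G D w \<gamma>"
    if w: "\<forall>a\<in>diagram_arcs G D. [\<omega> a = w (fst a)] (mod int m)" for w
  proof -
    have "?value \<omega> r = ?value (\<lambda>a. w (fst a)) r" if "r \<in> wirtinger_relators G D" for r
    proof (rule word_value_cong)
      show "r \<in> words (diagram_arcs G D)" using that wirtinger_relators_words[OF D] by blast
    qed (intro elem_cong, use w in simp_all)
    then show ?thesis using wirtinger_relators_hold_iff_coloring[OF D, of \<gamma> w] by simp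
  qed
  have "\<exists>w. \<forall>a\<in>diagram_arcs G D. [\<omega> a = w (fst a)] (mod int m)"
    if rel: "\<forall>r\<in>wirtinger_relators G D. ?value \<omega> r = \<one>\<^bsub>\<Gamma>\<^esub>"
  proof (intro exI ballI)
    fix a assume a: "a \<in> diagram_arcs G D"
    have "\<omega> (left_arc G D c) mod int m = \<omega> (right_arc G D c) mod int m"
      if c: "c \<in> crossings G D" for c
    proof -
      have "?value \<omega> (crossing_relator G D c) = \<one>\<^bsub>\<Gamma>\<^esub>"
        using rel c by (simp add: wirtinger_relators_def)
      then show ?thesis
        using crossing_relator_value_eq_one_iff[of \<gamma> \<omega> G D c] by (simp add: cong_def)
    qed
    then show "[\<omega> a = \<omega> (arc_at G D (fst a, 0))] (mod int m)"
      using constant_along_edges[OF D, where F = "\<lambda>a. \<omega> a mod int m", OF _ a]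
      by (simp add: cong_def)
  qed
  then show ?thesis
    unfolding wirtinger_rep_iff_relators_hold[OF D] using edge_weights by blast
qed

end

section \<open>Transport to the fundamental group\<close>

lemma metacyclic_rep_iso:
  assumes "group P" and \<theta>: "\<theta> \<in> iso P Q" and x: "\<And>a. a \<in> A \<Longrightarrow> x a \<in> carrier P"
  shows "(\<exists>\<phi>. metacyclic_rep p m k A Q (\<lambda>a. \<theta> (x a)) \<gamma> \<omega> \<phi>) \<longleftrightarrow>
    (\<exists>\<phi>. metacyclic_rep p m k A P x \<gamma> \<omega> \<phi>)"
proof
  assume "\<exists>\<phi>. metacyclic_rep p m k A Q (\<lambda>a. \<theta> (x a)) \<gamma> \<omega> \<phi>"
  then obtain \<phi> where \<phi>: "metacyclic_rep p m k A Q (\<lambda>a. \<theta> (x a)) \<gamma> \<omega> \<phi>" by blast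
  have "\<theta> \<in> hom P Q" using \<theta> by (simp add: iso_def)
  with \<phi> have "metacyclic_rep p m k A P x \<gamma> \<omega> (\<phi> \<circ> \<theta>)"
    by (auto simp: metacyclic_rep_def intro: hom_compose)
  then show "\<exists>\<phi>. metacyclic_rep p m k A P x \<gamma> \<omega> \<phi>" by blast
next
  assume "\<exists>\<phi>. metacyclic_rep p m k A P x \<gamma> \<omega> \<phi>"
  then obtain \<phi> where \<phi>: "metacyclic_rep p m k A P x \<gamma> \<omega> \<phi>" by blast
  let ?\<eta> = "inv_into (carrier P) \<theta>"
  have "?\<eta> \<in> hom Q P"
    using group.iso_set_sym[OF assms(1) \<theta>] by (simp add: iso_def)
  moreover have "?\<eta> (\<theta> (x a)) = x a" if "a \<in> A" for a
    using \<theta> x[OF that] by (simp add: iso_def bij_betw_def)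
  ultimately have "metacyclic_rep p m k A Q (\<lambda>a. \<theta> (x a)) \<gamma> \<omega> (\<phi> \<circ> ?\<eta>)"
    using \<phi> by (auto simp: metacyclic_rep_def intro: hom_compose)
  then show "\<exists>\<phi>. metacyclic_rep p m k A Q (\<lambda>a. \<theta> (x a)) \<gamma> \<omega> \<phi>" by blast
qed

theorem theorem3:
  fixes G :: "('v, 'e) spatial_graph" and D :: "('v, 'e) diagram" and p m k :: nat
  assumes "is_spatial_graph G" and "is_diagram G D"
    and "prime p" and "odd p" and "m > 0" and "k > 0" and "[k ^ m = 1] (mod p)"
  shows
    "(\<forall>\<phi> \<gamma> \<omega>.
        metacyclic_rep p m k (diagram_arcs G D) (wirtinger_group G D) (wirtinger_gen G D) \<gamma> \<omega> \<phi> \<longrightarrow>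
        (\<exists>w. (\<forall>a\<in>diagram_arcs G D. [\<omega> a = w (fst a)] (mod int m)) \<and>
             balanced_mod m G w \<and> is_coloring p k G D w \<gamma>))
     \<and>
     (\<forall>w \<gamma>. balanced_mod m G w \<and> is_coloring p k G D w \<gamma> \<longrightarrow>
        (\<exists>\<phi>. metacyclic_rep p m k (diagram_arcs G D) (wirtinger_group G D) (wirtinger_gen G D)
               \<gamma> (\<lambda>a. w (fst a)) \<phi>))
     \<and>
     (\<forall>x \<theta>. x \<in> topspace (graph_complement G) \<and>
        \<theta> \<in> iso (wirtinger_group G D) (fundamental_group (graph_complement G) x) \<longrightarrow>
        (\<forall>\<phi> \<gamma> \<omega>.
           metacyclic_rep p m k (diagram_arcs G D) (fundamental_group (graph_complement G) x)
             (\<lambda>a. \<theta> (wirtinger_gen G D a)) \<gamma> \<omega> \<phi> \<longrightarrow>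
           (\<exists>w. (\<forall>a\<in>diagram_arcs G D. [\<omega> a = w (fst a)] (mod int m)) \<and>
                balanced_mod m G w \<and> is_coloring p k G D w \<gamma>))
        \<and>
        (\<forall>w \<gamma>. balanced_mod m G w \<and> is_coloring p k G D w \<gamma> \<longrightarrow>
           (\<exists>\<phi>. metacyclic_rep p m k (diagram_arcs G D) (fundamental_group (graph_complement G) x)
                  (\<lambda>a. \<theta> (wirtinger_gen G D a)) \<gamma> (\<lambda>a. w (fst a)) \<phi>)))"
proof -
  interpret metacyclic_parameters p m k
    using assms by unfold_locales (auto simp: prime_gt_0_nat)
  note wirtinger = wirtinger_rep_iff_coloring[OF assms(2)]
  have gen: "wirtinger_gen G D a \<in> carrier (wirtinger_group G D)" if "a \<in> diagram_arcs G D" for a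
    using presented_gen_closed[OF that] by (simp add: wirtinger_gen_def wirtinger_group_def)
  have wirtinger_group: "group (wirtinger_group G D)"
    by (simp add: wirtinger_group_def group_presented_group)
  have fundamental: "(\<exists>\<phi>. metacyclic_rep p m k (diagram_arcs G D) (fundamental_group (graph_complement G) x)
             (\<lambda>a. \<theta> (wirtinger_gen G D a)) \<gamma> \<omega> \<phi>) \<longleftrightarrow>
    (\<exists>w. (\<forall>a\<in>diagram_arcs G D. [\<omega> a = w (fst a)] (mod int m)) \<and>
      balanced_mod m G w \<and> is_coloring p k G D w \<gamma>)"
    if "\<theta> \<in> iso (wirtinger_group G D) (fundamental_group (graph_complement G) x)" for x \<theta> \<gamma> \<omega>
    by (rule HOL.trans[OF metacyclic_rep_iso[OF wirtinger_group that] wirtinger]) (rule gen)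
  show ?thesis
  proof (intro conjI allI impI)
    fix \<phi> \<gamma> \<omega>
    assume "metacyclic_rep p m k (diagram_arcs G D) (wirtinger_group G D) (wirtinger_gen G D) \<gamma> \<omega> \<phi>"
    then show "\<exists>w. (\<forall>a\<in>diagram_arcs G D. [\<omega> a = w (fst a)] (mod int m)) \<and>
        balanced_mod m G w \<and> is_coloring p k G D w \<gamma>"
      using wirtinger by blast
  next
    fix w \<gamma> assume "balanced_mod m G w \<and> is_coloring p k G D w \<gamma>"
    then show "\<exists>\<phi>. metacyclic_rep p m k (diagram_arcs G D) (wirtinger_group G D)
        (wirtinger_gen G D) \<gamma> (\<lambda>a. w (fst a)) \<phi>"
      unfolding wirtinger by (intro exI[of _ w]) simp
  next
    fix x \<theta> \<phi> \<gamma> \<omega>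
    assume \<theta>: "x \<in> topspace (graph_complement G) \<and>
        \<theta> \<in> iso (wirtinger_group G D) (fundamental_group (graph_complement G) x)"
      and "metacyclic_rep p m k (diagram_arcs G D) (fundamental_group (graph_complement G) x)
             (\<lambda>a. \<theta> (wirtinger_gen G D a)) \<gamma> \<omega> \<phi>"
    then show "\<exists>w. (\<forall>a\<in>diagram_arcs G D. [\<omega> a = w (fst a)] (mod int m)) \<and>
        balanced_mod m G w \<and> is_coloring p k G D w \<gamma>"
      by (intro fundamental[OF conjunct2[OF \<theta>], THEN iffD1] exI)
  next
    fix x \<theta> w \<gamma>
    assume \<theta>: "x \<in> topspace (graph_complement G) \<and>
        \<theta> \<in> iso (wirtinger_group G D) (fundamental_group (graph_complement G) x)"
      and "balanced_mod m G w \<and> is_coloring p k G D w \<gamma>"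
    then show "\<exists>\<phi>. metacyclic_rep p m k (diagram_arcs G D) (fundamental_group (graph_complement G) x)
        (\<lambda>a. \<theta> (wirtinger_gen G D a)) \<gamma> (\<lambda>a. w (fst a)) \<phi>"
      unfolding fundamental[OF conjunct2[OF \<theta>]] by (intro exI[of _ w]) simp
  qed
qed

end
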